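(* Let $d\ge 1$ and let $H_0$ be a self-adjoint operator in $L^2(\mathbb R^d)$ with domain $D(H_0)$, bounded below, with compact resolvent, $\mathcal P$-symmetric and $\mathcal T$-symmetric. Let $\ell_1<\ell_2<\ldots$ be the increasing sequence of its distinct eigenvalues. Let $W\in L^\infty(\mathbb R^d)$ be real valued and odd, $W(-x)=-W(x)$, let $V:=iW$, and for $g\in\mathbb R$ let $H(g):=H_0+gV$ with domain $D(H(g))=D(H_0)$. Assume furthermore: (1) $\delta:=\frac12\inf_r(\ell_{r+1}-\ell_r)>0$; (2) each eigenvalue $\ell_r$, $r=1,2,\ldots$, is either even or odd. Then, if $g\in\mathbb R$ and $|g|<\dfrac{\delta}{\|W\|_\infty}$, each eigenvalue of $H(g)$ is real, and thus the spectrum of $H(g)$ is purely real.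
   Context: $(\mathcal P\psi)(x)=\psi(-x)$ on $L^2(\mathbb R^d)$. $H_0$ is $\mathcal P$-symmetric if $\mathcal P H_0\psi=H_0\mathcal P\psi$ for all $\psi\in D(H_0)$, and $\mathcal T$-symmetric if $\overline{H_0\psi}=H_0\overline\psi$ for all $\psi\in D(H_0)$ (in both cases $D(H_0)$ is preserved). The eigenspace of $\ell_r$ is $\mathcal M_r=\mathrm{Span}\{\psi_{r,s}:s=1,\ldots,m_r\}$, with $m_r$ the multiplicity of $\ell_r$ and the $\psi_{r,s}$ linearly independent eigenfunctions. The eigenvalue $\ell_r$ is called even if $\mathcal P\psi_{r,s}=\psi_{r,s}$ for all $s$, and odd if $\mathcal P\psi_{r,s}=-\psi_{r,s}$ for all $s$ (i.e. all functions in $\mathcal M_r$ are even, respectively odd). For each $g$ the operator $H(g)$ is closed with compact resolvent, so its spectrum consists of isolated eigenvalues of finite multiplicity. If $W=0$, $\delta/\|W\|_\infty$ is read as $+\infty$. *)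

theory Defs
  imports "HOL-Analysis.Analysis" "HOL-Probability.Essential_Supremum"
begin

section \<open>The Hilbert space of square-integrable functions\<close>

definition sq_integrable :: "('a::euclidean_space \<Rightarrow> complex) \<Rightarrow> bool" where
  "sq_integrable f \<longleftrightarrow>
     f \<in> borel_measurable lebesgue \<and> integrable lebesgue (\<lambda>x. (norm (f x))\<^sup>2)"

definition L2_rel :: "('a::euclidean_space \<Rightarrow> complex) \<Rightarrow> ('a \<Rightarrow> complex) \<Rightarrow> bool" where
  "L2_rel f g \<longleftrightarrow> sq_integrable f \<and> sq_integrable g \<and> (AE x in lebesgue. f x = g x)"

lemma sq_integrable_zero: "sq_integrable (\<lambda>x. 0)"
  by (simp add: sq_integrable_def)

lemma sq_integrable_measurable: "sq_integrable f \<Longrightarrow> f \<in> borel_measurable lebesgue"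
  by (simp add: sq_integrable_def)

lemma sq_integrable_bound:
  assumes "f \<in> borel_measurable lebesgue" "integrable lebesgue h"
    and "AE x in lebesgue. (norm (f x))\<^sup>2 \<le> h x"
  shows "sq_integrable f"
proof -
  have m: "(\<lambda>x. (norm (f x))\<^sup>2) \<in> borel_measurable lebesgue"
    using assms(1) by measurable
  have "integrable lebesgue (\<lambda>x. (norm (f x))\<^sup>2)"
    by (rule Bochner_Integration.integrable_bound[OF assms(2) m])
      (use assms(3) in \<open>auto elim!: eventually_mono\<close>)
  with assms(1) show ?thesis by (simp add: sq_integrable_def)
qed

lemma sq_integrable_scale:
  assumes "sq_integrable f" shows "sq_integrable (\<lambda>x. c * f x)"
proof -
  have [measurable]: "f \<in> borel_measurable lebesgue"
    using assms by (rule sq_integrable_measurable)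
  have "integrable lebesgue (\<lambda>x. (norm c)\<^sup>2 * (norm (f x))\<^sup>2)"
    using assms by (auto simp: sq_integrable_def)
  then show ?thesis
    by (auto simp: sq_integrable_def norm_mult power_mult_distrib)
qed

lemma sq_integrable_add:
  assumes "sq_integrable f" "sq_integrable g"
  shows "sq_integrable (\<lambda>x. f x + g x)"
proof (rule sq_integrable_bound)
  show "(\<lambda>x. f x + g x) \<in> borel_measurable lebesgue"
    using assms[THEN sq_integrable_measurable] by measurable
  show "integrable lebesgue (\<lambda>x. 2 * (norm (f x))\<^sup>2 + 2 * (norm (g x))\<^sup>2)"
    using assms by (auto simp: sq_integrable_def)
  show "AE x in lebesgue. (norm (f x + g x))\<^sup>2 \<le> 2 * (norm (f x))\<^sup>2 + 2 * (norm (g x))\<^sup>2"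
  proof (rule AE_I2)
    fix x
    have "(norm (f x + g x))\<^sup>2 \<le> (norm (f x) + norm (g x))\<^sup>2"
      by (intro power_mono norm_triangle_ineq) simp
    also have "\<dots> \<le> 2 * (norm (f x))\<^sup>2 + 2 * (norm (g x))\<^sup>2"
      using sum_squares_bound[of "norm (f x)" "norm (g x)"] by (simp add: power2_sum)
    finally show "(norm (f x + g x))\<^sup>2 \<le> 2 * (norm (f x))\<^sup>2 + 2 * (norm (g x))\<^sup>2" .
  qed
qed

lemma sq_integrable_prod:
  assumes "sq_integrable f" "sq_integrable g"
  shows "integrable lebesgue (\<lambda>x. cnj (f x) * g x)"
proof (rule Bochner_Integration.integrable_bound)
  have [measurable]: "f \<in> borel_measurable lebesgue" "g \<in> borel_measurable lebesgue"
    using assms by (auto dest: sq_integrable_measurable)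
  have "(\<lambda>x. cnj (f x)) \<in> borel_measurable lebesgue"
    by (rule borel_measurable_continuous_on[where f = cnj]) (auto intro: continuous_intros)
  then show "(\<lambda>x. cnj (f x) * g x) \<in> borel_measurable lebesgue" by measurable
  show "integrable lebesgue (\<lambda>x. (norm (f x))\<^sup>2 + (norm (g x))\<^sup>2)"
    using assms by (auto simp: sq_integrable_def)
  show "AE x in lebesgue. norm (cnj (f x) * g x) \<le> norm ((norm (f x))\<^sup>2 + (norm (g x))\<^sup>2)"
  proof (rule AE_I2)
    fix x
    have "2 * norm (f x) * norm (g x) \<le> (norm (f x))\<^sup>2 + (norm (g x))\<^sup>2"
      by (rule sum_squares_bound)
    moreover have "0 \<le> norm (f x) * norm (g x)" by simp
    ultimately have "norm (f x) * norm (g x) \<le> (norm (f x))\<^sup>2 + (norm (g x))\<^sup>2"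
      by linarith
    then show "norm (cnj (f x) * g x) \<le> norm ((norm (f x))\<^sup>2 + (norm (g x))\<^sup>2)"
      by (simp add: norm_mult)
  qed
qed

quotient_type (overloaded) 'a L2 = "'a::euclidean_space \<Rightarrow> complex" / partial: L2_rel
proof (rule part_equivpI)
  show "\<exists>f. L2_rel f f"
    using sq_integrable_zero by (auto simp: L2_rel_def)
  show "symp L2_rel"
    by (auto simp: symp_def L2_rel_def elim: eventually_mono)
  show "transp L2_rel"
    by (auto simp: transp_def L2_rel_def elim: eventually_elim2)
qed

lift_definition scaleC :: "complex \<Rightarrow> 'a::euclidean_space L2 \<Rightarrow> 'a L2" (infixr \<open>*\<^sub>C\<close> 75)
  is "\<lambda>c f x. c * f x"
  by (auto simp: L2_rel_def sq_integrable_scale elim: eventually_mono)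

text \<open>The inner product is linear in the second argument.\<close>

lift_definition cinner :: "'a::euclidean_space L2 \<Rightarrow> 'a L2 \<Rightarrow> complex"
  is "\<lambda>f g. \<integral>x. cnj (f x) * g x \<partial>lebesgue"
proof -
  fix f f' g g' :: "'a \<Rightarrow> complex"
  assume "L2_rel f f'" "L2_rel g g'"
  then have int: "integrable lebesgue (\<lambda>x. cnj (f x) * g x)"
      "integrable lebesgue (\<lambda>x. cnj (f' x) * g' x)"
    and ae: "AE x in lebesgue. f x = f' x" "AE x in lebesgue. g x = g' x"
    by (auto simp: L2_rel_def intro: sq_integrable_prod)
  have "AE x in lebesgue. cnj (f x) * g x = cnj (f' x) * g' x"
    using ae by eventually_elim simp
  then show "(\<integral>x. cnj (f x) * g x \<partial>lebesgue) = (\<integral>x. cnj (f' x) * g' x \<partial>lebesgue)"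
    using int by (intro integral_cong_AE) (auto dest: borel_measurable_integrable)
qed

instantiation L2 :: (euclidean_space) real_vector
begin

lift_definition zero_L2 :: "'a L2" is "\<lambda>x. 0"
  by (simp add: L2_rel_def sq_integrable_zero)

lift_definition plus_L2 :: "'a L2 \<Rightarrow> 'a L2 \<Rightarrow> 'a L2" is "\<lambda>f g x. f x + g x"
  by (auto simp: L2_rel_def sq_integrable_add elim: eventually_elim2)

definition uminus_L2 :: "'a L2 \<Rightarrow> 'a L2" where "uminus_L2 \<psi> = (- 1) *\<^sub>C \<psi>"

definition minus_L2 :: "'a L2 \<Rightarrow> 'a L2 \<Rightarrow> 'a L2" where "minus_L2 \<psi> \<phi> = \<psi> + - \<phi>"

definition scaleR_L2 :: "real \<Rightarrow> 'a L2 \<Rightarrow> 'a L2" where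
  "scaleR_L2 r \<psi> = complex_of_real r *\<^sub>C \<psi>"

instance
proof
  fix a b c :: "'a L2" and r s :: real
  show "a + b + c = a + (b + c)"
    by transfer (auto simp: L2_rel_def sq_integrable_add add.assoc)
  show "a + b = b + a"
    by transfer (auto simp: L2_rel_def sq_integrable_add add.commute)
  show "0 + a = a"
    by transfer (auto simp: L2_rel_def)
  show "- a + a = 0"
    unfolding uminus_L2_def by transfer (auto simp: L2_rel_def sq_integrable_zero)
  show "a - b = a + - b"
    by (rule minus_L2_def)
  show "r *\<^sub>R (a + b) = r *\<^sub>R a + r *\<^sub>R b"
    unfolding scaleR_L2_def
    by transfer (auto simp: L2_rel_def sq_integrable_add sq_integrable_scale distrib_left
        intro!: sq_integrable_add sq_integrable_scale)
  show "(r + s) *\<^sub>R a = r *\<^sub>R a + s *\<^sub>R a"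
    unfolding scaleR_L2_def
    by transfer (auto simp: L2_rel_def distrib_right
        intro!: sq_integrable_add sq_integrable_scale)
  show "r *\<^sub>R s *\<^sub>R a = (r * s) *\<^sub>R a"
    unfolding scaleR_L2_def
    by transfer (auto simp: L2_rel_def mult.assoc intro!: sq_integrable_scale)
  show "1 *\<^sub>R a = a"
    unfolding scaleR_L2_def by transfer (auto simp: L2_rel_def)
qed

end

lemma cinner_add_left: "cinner (a + b) c = cinner a c + cinner b c"
  by transfer (simp add: L2_rel_def distrib_right sq_integrable_prod)

lemma cinner_scaleC_left: "cinner (z *\<^sub>C a) b = cnj z * cinner a b"
  by transfer (simp add: L2_rel_def mult.assoc)

lemma cinner_commute:
  fixes a b :: "'a::euclidean_space L2"
  shows "cinner b a = cnj (cinner a b)"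
proof transfer
  fix f g :: "'a \<Rightarrow> complex"
  have "(\<lambda>x. cnj (g x) * f x) = (\<lambda>x. cnj (cnj (f x) * g x))"
    by (simp add: mult.commute)
  then show "(\<integral>x. cnj (g x) * f x \<partial>lebesgue) = cnj (\<integral>x. cnj (f x) * g x \<partial>lebesgue)"
    by (simp only: Bochner_Integration.integral_cnj)
qed

lemma cinner_self:
  fixes a :: "'a::euclidean_space L2"
  shows "Im (cinner a a) = 0" "Re (cinner a a) \<ge> 0" "Re (cinner a a) = 0 \<longleftrightarrow> a = 0"
proof -
  have eq: "(\<integral>x. cnj (f x) * f x \<partial>lebesgue)
      = complex_of_real (\<integral>x. (norm (f x))\<^sup>2 \<partial>lebesgue)"
    for f :: "'a \<Rightarrow> complex"
    by (subst integral_complex_of_real[symmetric]) (simp add: complex_norm_square mult.commute del: of_real_power)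
  show "Im (cinner a a) = 0"
    by transfer (simp add: eq)
  show "Re (cinner a a) \<ge> 0"
    by transfer (simp add: eq)
  show "Re (cinner a a) = 0 \<longleftrightarrow> a = 0"
  proof transfer
    fix f :: "'a \<Rightarrow> complex"
    assume "L2_rel f f"
    then have "sq_integrable f" by (simp add: L2_rel_def)
    then have "(\<integral>x. (norm (f x))\<^sup>2 \<partial>lebesgue) = 0 \<longleftrightarrow> (AE x in lebesgue. (norm (f x))\<^sup>2 = 0)"
      by (intro integral_nonneg_eq_0_iff_AE) (auto simp: sq_integrable_def)
    then show "Re (\<integral>x. cnj (f x) * f x \<partial>lebesgue) = 0 \<longleftrightarrow> L2_rel f (\<lambda>x. 0)"
      using \<open>sq_integrable f\<close> by (simp add: eq L2_rel_def sq_integrable_zero)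
  qed
qed

instantiation L2 :: (euclidean_space) real_inner
begin

definition inner_L2 :: "'a L2 \<Rightarrow> 'a L2 \<Rightarrow> real" where "inner_L2 \<psi> \<phi> = Re (cinner \<psi> \<phi>)"
definition norm_L2 :: "'a L2 \<Rightarrow> real" where "norm_L2 \<psi> = sqrt (inner \<psi> \<psi>)"
definition sgn_L2 :: "'a L2 \<Rightarrow> 'a L2" where "sgn_L2 \<psi> = \<psi> /\<^sub>R norm \<psi>"
definition dist_L2 :: "'a L2 \<Rightarrow> 'a L2 \<Rightarrow> real" where "dist_L2 \<psi> \<phi> = norm (\<psi> - \<phi>)"
definition uniformity_L2 :: "('a L2 \<times> 'a L2) filter" where
  "uniformity_L2 = (INF e\<in>{0<..}. principal {(\<psi>, \<phi>). dist \<psi> \<phi> < e})"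
definition open_L2 :: "'a L2 set \<Rightarrow> bool" where
  "open_L2 U \<longleftrightarrow> (\<forall>\<psi>\<in>U. eventually (\<lambda>(\<psi>', \<phi>). \<psi>' = \<psi> \<longrightarrow> \<phi> \<in> U) uniformity)"

instance
proof
  fix a b c :: "'a L2" and r :: real and U :: "'a L2 set"
  show "dist a b = norm (a - b)" by (rule dist_L2_def)
  show "sgn a = inverse (norm a) *\<^sub>R a" by (rule sgn_L2_def)
  show "uniformity = (INF e\<in>{0<..}. principal {(x, y). dist (x::'a L2) y < e})"
    by (rule uniformity_L2_def)
  show "open U = (\<forall>x\<in>U. \<forall>\<^sub>F (x', y) in uniformity. x' = x \<longrightarrow> y \<in> U)"
    by (rule open_L2_def)
  show "inner a b = inner b a"
    unfolding inner_L2_def by (subst cinner_commute) simp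
  show "inner (a + b) c = inner a c + inner b c"
    by (simp add: inner_L2_def cinner_add_left)
  show "inner (r *\<^sub>R a) b = r * inner a b"
    by (simp add: inner_L2_def scaleR_L2_def cinner_scaleC_left)
  show "0 \<le> inner a a" "inner a a = 0 \<longleftrightarrow> a = 0"
    by (simp_all add: inner_L2_def cinner_self)
  show "norm a = sqrt (inner a a)" by (rule norm_L2_def)
qed

end


section \<open>Parity, complex conjugation, multiplication operators\<close>

lemma lebesgue_distr_uminus: "distr lebesgue lebesgue uminus = (lebesgue :: 'a::euclidean_space measure)"
proof -
  have *: "(\<lambda>x::'a. 0 + (\<Sum>j\<in>Basis. (- 1 * (x \<bullet> j)) *\<^sub>R j)) = uminus"
    by (rule ext) (simp add: sum_negf euclidean_representation)
  have "(lebesgue :: 'a measure)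
      = density (distr lebesgue lebesgue uminus) (\<lambda>_. (\<Prod>j\<in>(Basis::'a set). \<bar>- 1 :: real\<bar>))"
    using lebesgue_affine_euclidean[of "\<lambda>_. - 1" "0::'a"] unfolding * by simp
  then show ?thesis by (simp add: density_1)
qed

lemma uminus_lebesgue_measurable: "uminus \<in> lebesgue \<rightarrow>\<^sub>M (lebesgue :: 'a::euclidean_space measure)"
  using lebesgue_measurable_scaling[of "- 1 :: real"] by (simp add: scaleR_minus1_left[abs_def])

lemma AE_lebesgue_uminus:
  fixes P :: "'a::euclidean_space \<Rightarrow> bool"
  assumes "AE x in lebesgue. P x" shows "AE x in lebesgue. P (- x)"
proof -
  have "AE x in distr lebesgue lebesgue uminus. P x"
    using assms by (subst lebesgue_distr_uminus)
  then show ?thesis by (rule AE_distrD[OF uminus_lebesgue_measurable])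
qed

lemma sq_integrable_uminus:
  fixes f :: "'a::euclidean_space \<Rightarrow> complex"
  assumes "sq_integrable f" shows "sq_integrable (\<lambda>x. f (- x))"
proof -
  have "integrable (distr lebesgue lebesgue uminus) (\<lambda>x. (norm (f x))\<^sup>2)"
    using assms by (simp add: lebesgue_distr_uminus sq_integrable_def)
  then have "integrable lebesgue (\<lambda>x. (norm (f (- x)))\<^sup>2)"
    by (rule integrable_distr[OF uminus_lebesgue_measurable])
  moreover have "(\<lambda>x. f (- x)) \<in> borel_measurable lebesgue"
    using measurable_compose[OF uminus_lebesgue_measurable sq_integrable_measurable[OF assms]] .
  ultimately show ?thesis by (simp add: sq_integrable_def)
qed

lift_definition parity :: "'a::euclidean_space L2 \<Rightarrow> 'a L2" is "\<lambda>f x. f (- x)"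
  unfolding L2_rel_def by (intro conjI; elim conjE; rule sq_integrable_uminus AE_lebesgue_uminus)

lemma sq_integrable_cnj: "sq_integrable f \<Longrightarrow> sq_integrable (\<lambda>x. cnj (f x))"
  by (auto simp: sq_integrable_def
      intro!: borel_measurable_continuous_on[where f = cnj] continuous_intros)

lift_definition conj_L2 :: "'a::euclidean_space L2 \<Rightarrow> 'a L2" is "\<lambda>f x. cnj (f x)"
  by (auto simp: L2_rel_def sq_integrable_cnj elim: eventually_mono)

text \<open>With values in \<^typ>\<open>ereal\<close>, where \<open>x / 0 = \<infinity>\<close> for \<open>x > 0\<close>.\<close>

definition Linf_norm :: "('a::euclidean_space \<Rightarrow> 'b::real_normed_vector) \<Rightarrow> ereal" where
  "Linf_norm f = esssup lebesgue (\<lambda>x. ereal (norm (f x)))"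

definition in_Linf :: "('a::euclidean_space \<Rightarrow> 'b::real_normed_vector) \<Rightarrow> bool" where
  "in_Linf f \<longleftrightarrow> f \<in> borel_measurable lebesgue \<and> Linf_norm f < \<infinity>"

lemma in_Linf_AE_bound:
  assumes "in_Linf f" obtains B where "AE x in lebesgue. norm (f x) \<le> B"
proof -
  have ae: "AE x in lebesgue. ereal (norm (f x)) \<le> Linf_norm f"
    unfolding Linf_norm_def by (rule esssup_AE)
  have "AE x in lebesgue. norm (f x) \<le> real_of_ereal (Linf_norm f)"
    using ae
  proof eventually_elim
    case (elim x)
    with assms show ?case by (cases "Linf_norm f") (auto simp: in_Linf_def)
  qed
  with that show thesis .
qed

lemma sq_integrable_Linf_mult:
  assumes "in_Linf V" "sq_integrable f" shows "sq_integrable (\<lambda>x. V x * f x)"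
proof -
  obtain B where B: "AE x in lebesgue. norm (V x) \<le> B"
    using assms(1) by (rule in_Linf_AE_bound)
  have [measurable]: "V \<in> borel_measurable lebesgue" "f \<in> borel_measurable lebesgue"
    using assms by (auto simp: in_Linf_def sq_integrable_def)
  show ?thesis
  proof (rule sq_integrable_bound)
    show "(\<lambda>x. V x * f x) \<in> borel_measurable lebesgue" by measurable
    show "integrable lebesgue (\<lambda>x. B\<^sup>2 * (norm (f x))\<^sup>2)"
      using assms(2) by (auto simp: sq_integrable_def)
    show "AE x in lebesgue. (norm (V x * f x))\<^sup>2 \<le> B\<^sup>2 * (norm (f x))\<^sup>2"
      using B by eventually_elim
        (auto simp: norm_mult power_mult_distrib intro!: mult_right_mono power_mono)
  qed
qed

text \<open>The value \<open>0\<close> for \<open>V\<close> not in \<open>L\<^sup>\<infinity>\<close> only makes the function total.\<close>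

lift_definition mult_op :: "('a::euclidean_space \<Rightarrow> complex) \<Rightarrow> 'a L2 \<Rightarrow> 'a L2"
  is "\<lambda>V f x. if in_Linf V then V x * f x else 0"
  subgoal for V f g
    by (cases "in_Linf V")
      (auto simp: L2_rel_def sq_integrable_Linf_mult sq_integrable_zero elim: eventually_mono)
  done


section \<open>Unbounded operators\<close>

text \<open>An operator is given by its domain \<open>D\<close> and a total function \<open>A\<close>, whose values outside
  \<open>D\<close> are irrelevant.\<close>

definition linear_operator :: "'a::euclidean_space L2 set \<Rightarrow> ('a L2 \<Rightarrow> 'a L2) \<Rightarrow> bool" where
  "linear_operator D A \<longleftrightarrow>
     0 \<in> D \<and>
     (\<forall>\<psi>\<in>D. \<forall>\<phi>\<in>D. \<psi> + \<phi> \<in> D \<and> A (\<psi> + \<phi>) = A \<psi> + A \<phi>) \<and>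
     (\<forall>c. \<forall>\<psi>\<in>D. c *\<^sub>C \<psi> \<in> D \<and> A (c *\<^sub>C \<psi>) = c *\<^sub>C A \<psi>)"

definition op_graph :: "'a::euclidean_space L2 set \<Rightarrow> ('a L2 \<Rightarrow> 'a L2) \<Rightarrow> ('a L2 \<times> 'a L2) set" where
  "op_graph D A = {(\<psi>, A \<psi>) |\<psi>. \<psi> \<in> D}"

definition adjoint_graph :: "'a::euclidean_space L2 set \<Rightarrow> ('a L2 \<Rightarrow> 'a L2) \<Rightarrow> ('a L2 \<times> 'a L2) set" where
  "adjoint_graph D A = {(\<phi>, \<eta>). \<forall>\<psi>\<in>D. cinner \<phi> (A \<psi>) = cinner \<eta> \<psi>}"

definition self_adjoint :: "'a::euclidean_space L2 set \<Rightarrow> ('a L2 \<Rightarrow> 'a L2) \<Rightarrow> bool" where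
  "self_adjoint D A \<longleftrightarrow>
     linear_operator D A \<and> closure D = UNIV \<and> adjoint_graph D A = op_graph D A"

definition bounded_below :: "'a::euclidean_space L2 set \<Rightarrow> ('a L2 \<Rightarrow> 'a L2) \<Rightarrow> bool" where
  "bounded_below D A \<longleftrightarrow> (\<exists>c. \<forall>\<psi>\<in>D. Re (cinner \<psi> (A \<psi>)) \<ge> c * (norm \<psi>)\<^sup>2)"

text \<open>For linear \<open>A\<close> the resolvent is complex linear, so the real notion \<^const>\<open>bounded_linear\<close>
  below only expresses its boundedness.\<close>

definition resolvent :: "'a::euclidean_space L2 set \<Rightarrow> ('a L2 \<Rightarrow> 'a L2) \<Rightarrow> complex \<Rightarrow> 'a L2 \<Rightarrow> 'a L2" where
  "resolvent D A z = inv_into D (\<lambda>\<psi>. A \<psi> - z *\<^sub>C \<psi>)"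

definition resolvent_set :: "'a::euclidean_space L2 set \<Rightarrow> ('a L2 \<Rightarrow> 'a L2) \<Rightarrow> complex set" where
  "resolvent_set D A =
     {z. bij_betw (\<lambda>\<psi>. A \<psi> - z *\<^sub>C \<psi>) D UNIV \<and> bounded_linear (resolvent D A z)}"

definition spectrum :: "'a::euclidean_space L2 set \<Rightarrow> ('a L2 \<Rightarrow> 'a L2) \<Rightarrow> complex set" where
  "spectrum D A = - resolvent_set D A"

definition compact_operator :: "('a::euclidean_space L2 \<Rightarrow> 'a L2) \<Rightarrow> bool" where
  "compact_operator K \<longleftrightarrow> (\<forall>S. bounded S \<longrightarrow> compact (closure (K ` S)))"

definition compact_resolvent :: "'a::euclidean_space L2 set \<Rightarrow> ('a L2 \<Rightarrow> 'a L2) \<Rightarrow> bool" where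
  "compact_resolvent D A \<longleftrightarrow> (\<exists>z\<in>resolvent_set D A. compact_operator (resolvent D A z))"

definition eigenspace :: "'a::euclidean_space L2 set \<Rightarrow> ('a L2 \<Rightarrow> 'a L2) \<Rightarrow> complex \<Rightarrow> 'a L2 set" where
  "eigenspace D A z = {\<psi>\<in>D. A \<psi> = z *\<^sub>C \<psi>}"

definition eigenvalues :: "'a::euclidean_space L2 set \<Rightarrow> ('a L2 \<Rightarrow> 'a L2) \<Rightarrow> complex set" where
  "eigenvalues D A = {z. \<exists>\<psi>\<in>eigenspace D A z. \<psi> \<noteq> 0}"

definition P_symmetric :: "'a::euclidean_space L2 set \<Rightarrow> ('a L2 \<Rightarrow> 'a L2) \<Rightarrow> bool" where
  "P_symmetric D A \<longleftrightarrow> (\<forall>\<psi>\<in>D. parity \<psi> \<in> D \<and> parity (A \<psi>) = A (parity \<psi>))"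

definition T_symmetric :: "'a::euclidean_space L2 set \<Rightarrow> ('a L2 \<Rightarrow> 'a L2) \<Rightarrow> bool" where
  "T_symmetric D A \<longleftrightarrow> (\<forall>\<psi>\<in>D. conj_L2 \<psi> \<in> D \<and> conj_L2 (A \<psi>) = A (conj_L2 \<psi>))"

definition even_eigenvalue :: "'a::euclidean_space L2 set \<Rightarrow> ('a L2 \<Rightarrow> 'a L2) \<Rightarrow> complex \<Rightarrow> bool" where
  "even_eigenvalue D A z \<longleftrightarrow> z \<in> eigenvalues D A \<and> (\<forall>\<psi>\<in>eigenspace D A z. parity \<psi> = \<psi>)"

definition odd_eigenvalue :: "'a::euclidean_space L2 set \<Rightarrow> ('a L2 \<Rightarrow> 'a L2) \<Rightarrow> complex \<Rightarrow> bool" where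
  "odd_eigenvalue D A z \<longleftrightarrow> z \<in> eigenvalues D A \<and> (\<forall>\<psi>\<in>eigenspace D A z. parity \<psi> = - \<psi>)"

text \<open>\<open>H(g) = H\<^sub>0 + g V\<close> with \<open>V = i W\<close>, to be read on the domain of \<open>H\<^sub>0\<close>.\<close>

definition perturbed ::
  "('a::euclidean_space L2 \<Rightarrow> 'a L2) \<Rightarrow> ('a \<Rightarrow> real) \<Rightarrow> real \<Rightarrow> 'a L2 \<Rightarrow> 'a L2" where
  "perturbed H\<^sub>0 W g \<psi> =
     H\<^sub>0 \<psi> + complex_of_real g *\<^sub>C mult_op (\<lambda>x. \<i> * complex_of_real (W x)) \<psi>"

end

theory Submission
  imports Defs
begin

text \<open>Let \<open>E\<close> be a non-real eigenvalue of \<open>H(g)\<close> with eigenfunction \<open>\<psi>\<close>, and let \<open>u\<close>, \<open>v\<close> be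
  the even and odd parts of \<open>\<psi>\<close>. Since \<open>V\<close> exchanges parities,
  \<open>(H\<^sub>0 - E) u = - g V v\<close> and \<open>(H\<^sub>0 - E) v = - g V u\<close>. As \<open>V\<close> is skew-adjoint, the imaginary
  parts of the corresponding quadratic forms give \<open>\<parallel>u\<parallel> = \<parallel>v\<parallel>\<close>. Hence
  \<open>\<parallel>(H\<^sub>0 - Re E) u\<parallel> < \<delta> \<parallel>u\<parallel>\<close>, and likewise for \<open>v\<close>, so \<open>H\<^sub>0\<close> has both an even and an odd
  eigenvalue at distance less than \<open>\<delta>\<close> from \<open>Re E\<close>, contradicting the gap \<open>2 \<delta>\<close>.
  By the Fredholm alternative the non-real points, not being eigenvalues, lie in the
  resolvent set. Both this alternative (via Riesz's lemma) and the extremal eigenvalue of a compact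
  symmetric operator are available without completeness of the space.\<close>

section \<open>Compact operators on normed spaces\<close>

text \<open>Compactness is put in sequential form because the arguments below extract subsequences.
  The limit is required to exist in the codomain itself, which takes the place of
  completeness.\<close>

definition compact_map :: "('a::real_normed_vector \<Rightarrow> 'b::real_normed_vector) \<Rightarrow> bool" where
  "compact_map K \<longleftrightarrow> bounded_linear K \<and>
     (\<forall>x::nat \<Rightarrow> 'a. bounded (range x) \<longrightarrow> (\<exists>r l. strict_mono r \<and> (\<lambda>n. K (x (r n))) \<longlonglongrightarrow> l))"

lemma compact_map_bounded_linear: "compact_map K \<Longrightarrow> bounded_linear K"
  by (simp add: compact_map_def)

lemma compact_mapE:
  fixes x :: "nat \<Rightarrow> 'a::real_normed_vector"
  assumes "compact_map K" "\<And>n. norm (x n) \<le> C"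
  obtains r l where "strict_mono r" "(\<lambda>n. K (x (r n))) \<longlonglongrightarrow> l"
proof -
  have "bounded (range x)" using assms(2) by (auto simp: bounded_iff)
  then have "\<exists>r l. strict_mono r \<and> (\<lambda>n. K (x (r n))) \<longlonglongrightarrow> l"
    using assms(1) by (simp add: compact_map_def)
  then show thesis using that by blast
qed

lemma compact_map_comp_left:
  fixes K :: "'a::real_normed_vector \<Rightarrow> 'b::real_normed_vector"
  assumes "bounded_linear B" "compact_map K"
  shows "compact_map (\<lambda>x. B (K x))"
  unfolding compact_map_def
proof (intro conjI allI impI)
  show "bounded_linear (\<lambda>x. B (K x))"
    by (rule bounded_linear_compose[OF assms(1) compact_map_bounded_linear[OF assms(2)]])
  fix x :: "nat \<Rightarrow> 'a" assume "bounded (range x)"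
  then obtain r l where "strict_mono r" "(\<lambda>n. K (x (r n))) \<longlonglongrightarrow> l"
    using assms(2) unfolding compact_map_def by blast
  then show "\<exists>r l. strict_mono r \<and> (\<lambda>n. B (K (x (r n)))) \<longlonglongrightarrow> l"
    using bounded_linear.tendsto[OF assms(1)] by blast
qed

lemma compact_map_comp_right:
  fixes B :: "'a::real_normed_vector \<Rightarrow> 'b::real_normed_vector"
  assumes "compact_map K" "bounded_linear B"
  shows "compact_map (\<lambda>x. K (B x))"
  unfolding compact_map_def
proof (intro conjI allI impI)
  show "bounded_linear (\<lambda>x. K (B x))"
    by (rule bounded_linear_compose[OF compact_map_bounded_linear[OF assms(1)] assms(2)])
  fix x :: "nat \<Rightarrow> 'a" assume "bounded (range x)"
  then have "bounded (range (\<lambda>n. B (x n)))"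
    using bounded_linear_image[OF _ assms(2)] by (simp add: image_image[symmetric])
  then show "\<exists>r l. strict_mono r \<and> (\<lambda>n. K (B (x (r n)))) \<longlonglongrightarrow> l"
    using assms(1) unfolding compact_map_def by blast
qed

section \<open>Riesz's lemma and the Fredholm alternative\<close>

text \<open>A point \<open>w\<close> of \<open>X\<close> outside the closed \<open>Y\<close> has
  positive distance to \<open>Y\<close>. If \<open>y\<close> realises that distance up to a factor
  2, the normalised \<open>w - y\<close> works.\<close>

lemma riesz_almost_orthogonal:
  fixes X Y :: "'a::real_normed_vector set"
  assumes "subspace X" "subspace Y" "closed Y" "Y \<subseteq> X" "Y \<noteq> X"
  obtains x where "x \<in> X" "norm x = 1" "\<And>y. y \<in> Y \<Longrightarrow> 1/2 \<le> norm (x - y)"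
proof -
  obtain w where w: "w \<in> X" "w \<notin> Y" using assms by blast
  have ne: "Y \<noteq> {}" using subspace_0[OF assms(2)] by blast
  have d: "infdist w Y > 0"
    using in_closed_iff_infdist_zero[OF assms(3) ne, of w] w infdist_nonneg[of w Y] by linarith
  then have "\<exists>y\<in>Y. dist w y < 2 * infdist w Y"
    using infdist_attains_inf infdist_notempty[OF ne, of w]
      cInf_lessD[of "(\<lambda>y. dist w y) ` Y" "2 * infdist w Y"] ne by auto
  then obtain y where y: "y \<in> Y" "dist w y < 2 * infdist w Y" by blast
  define n where "n = norm (w - y)"
  have n: "n > 0" "n < 2 * infdist w Y"
    using w y by (auto simp: n_def dist_norm)
  show thesis
  proof
    show "(w - y) /\<^sub>R n \<in> X"
      using w y assms by (meson subspace_diff subspace_scale subsetD)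
    show "norm ((w - y) /\<^sub>R n) = 1" using n by (simp add: n_def)
    fix z assume z: "z \<in> Y"
    \<comment> \<open>This is the point of \<open>Y\<close> to compare with \<open>w\<close>: its
      difference from \<open>w\<close> is \<open>n\<close> times the difference to be estimated, and
      \<open>n < 2 * infdist w Y\<close>.\<close>
    have "y + n *\<^sub>R z \<in> Y" using y z assms(2) by (simp add: subspace_add subspace_scale)
    then have "infdist w Y \<le> norm (w - (y + n *\<^sub>R z))"
      using infdist_le[of _ Y w] by (simp add: dist_norm)
    also have "w - (y + n *\<^sub>R z) = n *\<^sub>R ((w - y) /\<^sub>R n - z)"
      using n by (simp add: algebra_simps)
    also have "norm \<dots> = n * norm ((w - y) /\<^sub>R n - z)" using n by simp
    finally have "n * (1/2) \<le> n * norm ((w - y) /\<^sub>R n - z)" using n by linarith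
    then show "1/2 \<le> norm ((w - y) /\<^sub>R n - z)" using n by simp
  qed
qed

text \<open>Otherwise there are unit vectors \<open>x n\<close> with \<open>x n + K (x n)\<close>
  tending to 0. Along a subsequence on which \<open>K (x n)\<close> converges, \<open>x n\<close>
  converges too, and its limit is a unit vector in the kernel of \<open>1 + K\<close>.\<close>

lemma compact_perturbation_bounded_below:
  fixes K :: "'a::real_normed_vector \<Rightarrow> 'a"
  assumes K: "compact_map K" and inj: "\<And>x. x + K x = 0 \<Longrightarrow> x = 0"
  obtains c where "c > 0" "\<And>x. c * norm x \<le> norm (x + K x)"
proof (rule ccontr)
  assume "\<not> thesis"
  with that have *: "\<forall>c>0. \<exists>x. norm (x + K x) < c * norm x" by (meson not_le)
  interpret bounded_linear K using K by (rule compact_map_bounded_linear)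
  have "\<exists>x. norm x = 1 \<and> norm (x + K x) < 1 / Suc n" for n
  proof -
    obtain x where x: "norm (x + K x) < (1 / Suc n) * norm x"
      using *[rule_format, of "1 / Suc n"] by auto
    then have nz: "norm x > 0" by (cases "x = 0") (auto simp: zero)
    have "x /\<^sub>R norm x + K (x /\<^sub>R norm x) = (x + K x) /\<^sub>R norm x"
      by (simp add: scaleR scaleR_right_distrib)
    then have "norm (x /\<^sub>R norm x + K (x /\<^sub>R norm x)) = norm (x + K x) / norm x"
      by (simp add: divide_inverse)
    also have "\<dots> < 1 / Suc n" using x nz by (simp add: divide_less_eq)
    finally show ?thesis using nz by (intro exI[of _ "x /\<^sub>R norm x"]) auto
  qed
  then obtain x where x: "\<And>n. norm (x n) = 1" "\<And>n. norm (x n + K (x n)) < 1 / Suc n" by metis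
  obtain r l where r: "strict_mono r" "(\<lambda>n. K (x (r n))) \<longlonglongrightarrow> l"
    using compact_mapE[OF K, of x 1] x(1) by auto
  have "(\<lambda>n. x n + K (x n)) \<longlonglongrightarrow> 0"
    by (rule Lim_null_comparison[OF _ LIMSEQ_inverse_real_of_nat])
      (use x(2) in \<open>auto intro!: always_eventually less_imp_le simp: inverse_eq_divide\<close>)
  then have lim0: "(\<lambda>n. x (r n) + K (x (r n))) \<longlonglongrightarrow> 0"
    using LIMSEQ_subseq_LIMSEQ[OF _ r(1)] by (auto simp: o_def)
  from tendsto_diff[OF this r(2)] have xl: "(\<lambda>n. x (r n)) \<longlonglongrightarrow> - l" by simp
  from tendsto_add[OF this tendsto[OF xl]] have "- l + K (- l) = 0"
    using lim0 LIMSEQ_unique by blast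
  then have "l = 0" using inj[of "- l"] by simp
  with tendsto_norm[OF xl] x(1) show False by (simp add: LIMSEQ_const_iff)
qed

text \<open>If \<open>T = 1 + K\<close> is injective but not onto, its iterated ranges form a
  strictly decreasing chain of closed subspaces. Riesz's lemma picks a unit vector in each, away
  from the next one, and \<open>K\<close> maps these to points at mutual distance at least 1/2,
  which compactness forbids.\<close>

lemma compact_perturbation_surj:
  fixes K :: "'a::real_normed_vector \<Rightarrow> 'a"
  assumes K: "compact_map K" and inj: "\<And>x. x + K x = 0 \<Longrightarrow> x = 0"
  shows "surj (\<lambda>x. x + K x)"
proof (rule ccontr)
  assume ns: "\<not> ?thesis"
  interpret K: bounded_linear K using K by (rule compact_map_bounded_linear)
  define T where "T = (\<lambda>x. x + K x)"
  interpret T: bounded_linear T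
    unfolding T_def by (intro bounded_linear_add bounded_linear_ident K.bounded_linear)
  obtain c where c: "c > 0" "\<And>x. c * norm x \<le> norm (T x)"
    using compact_perturbation_bounded_below[OF K inj] unfolding T_def by blast
  have injT: "x = y" if "T x = T y" for x y
    using inj[of "x - y"] that by (simp add: T_def K.diff algebra_simps)
  \<comment> \<open>The lower bound \<open>c\<close> keeps the preimages \<open>x n\<close> of a
    convergent sequence \<open>y n\<close> bounded, so \<open>K (x n)\<close> converges along a
    subsequence, and with it \<open>x n = y n - K (x n)\<close>.\<close>
  have closed_image: "closed (T ` X)" if X: "closed X" for X
    unfolding closed_sequential_limits
  proof (intro allI impI, elim conjE)
    fix y l assume yX: "\<forall>n. y n \<in> T ` X" and yl: "y \<longlonglongrightarrow> l"
    from yX have "\<forall>n. \<exists>x. x \<in> X \<and> y n = T x" by blast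
    then obtain x where x: "\<And>n. x n \<in> X" "\<And>n. y n = T (x n)" by metis
    obtain B where B: "\<And>n. norm (y n) \<le> B"
      using convergent_imp_bounded[OF yl] by (auto simp: bounded_iff)
    have "norm (x n) \<le> B / c" for n
      using c(2)[of "x n"] B[of n] c(1) x(2)[of n] by (simp add: field_simps)
    then obtain r m where r: "strict_mono r" "(\<lambda>n. K (x (r n))) \<longlonglongrightarrow> m"
      using compact_mapE[OF K] by blast
    have yr: "(\<lambda>n. y (r n)) \<longlonglongrightarrow> l" using LIMSEQ_subseq_LIMSEQ[OF yl r(1)] by (simp add: o_def)
    from tendsto_diff[OF yr r(2)] have xr: "(\<lambda>n. x (r n)) \<longlonglongrightarrow> l - m"
      by (simp add: x(2) T_def)
    then have "l - m \<in> X" using closed_sequentially[OF X, of "\<lambda>n. x (r n)"] x(1) by blast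
    moreover have "T (l - m) = l"
      using T.tendsto[OF xr] yr unfolding x(2) by (rule LIMSEQ_unique)
    ultimately show "l \<in> T ` X" by force
  qed
  define X where "X n = range (T ^^ n)" for n
  have X_Suc: "X (Suc n) = T ` X n" for n by (simp add: X_def image_comp)
  have clX: "closed (X n)" for n
    by (induction n) (simp_all only: X_Suc closed_image, simp add: X_def)
  have suX: "subspace (X n)" for n
  proof (induction n)
    case 0 show ?case by (simp add: X_def)
  next
    case (Suc n) then show ?case
      unfolding X_Suc by (intro linear_subspace_image T.linear)
  qed
  have X_dec1: "X (Suc n) \<subseteq> X n" for n
    by (induction n) (simp add: X_def, metis X_Suc image_mono)
  have X_dec: "X m \<subseteq> X n" if "n \<le> m" for m n
    using lift_Suc_antimono_le[of X n m] X_dec1 that by blast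
  \<comment> \<open>Failure of surjectivity gives the first strict inclusion, and injectivity of
    \<open>T\<close> carries it down the chain.\<close>
  have X_ne: "X (Suc n) \<noteq> X n" for n
  proof (induction n)
    case 0
    then show ?case using ns unfolding T_def[symmetric] by (simp add: X_def)
  next
    case (Suc n)
    have "inj T" using injT by (rule injI)
    then show ?case using Suc by (simp add: X_Suc inj_image_eq_iff)
  qed
  have "\<exists>x. x \<in> X n \<and> norm x = 1 \<and> (\<forall>y\<in>X (Suc n). 1/2 \<le> norm (x - y))" for n
    using riesz_almost_orthogonal[OF suX[of n] suX[of "Suc n"] clX X_dec1 X_ne] by metis
  then obtain x where x: "\<And>n. x n \<in> X n" "\<And>n. norm (x n) = 1"
    "\<And>n y. y \<in> X (Suc n) \<Longrightarrow> 1/2 \<le> norm (x n - y)" by metis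
  have sep: "1/2 \<le> norm (K (x n) - K (x m))" if "n < m" for n m
  proof -
    have "T (x n) \<in> X (Suc n)" "T (x m) \<in> X (Suc m)" using x(1) by (auto simp: X_Suc)
    moreover have "X (Suc m) \<subseteq> X (Suc n)" "X m \<subseteq> X (Suc n)" using that by (auto intro!: X_dec)
    \<comment> \<open>This vector is chosen so that subtracting it from \<open>x n\<close> leaves
      exactly \<open>K (x m) - K (x n)\<close>.\<close>
    ultimately have "T (x n) - T (x m) + x m \<in> X (Suc n)"
      using x(1)[of m] suX[of "Suc n"] by (meson subsetD subspace_add subspace_diff)
    from x(3)[OF this] have "1/2 \<le> norm (- (K (x n) - K (x m)))" by (simp add: T_def)
    then show ?thesis by (simp only: norm_minus_cancel)
  qed
  obtain r l where r: "strict_mono r" "(\<lambda>n. K (x (r n))) \<longlonglongrightarrow> l"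
    using compact_mapE[OF K, of x 1] x(2) by auto
  obtain N where N: "\<And>m n. m \<ge> N \<Longrightarrow> n \<ge> N \<Longrightarrow> norm (K (x (r m)) - K (x (r n))) < 1/2"
    using CauchyD[OF LIMSEQ_imp_Cauchy[OF r(2)], of "1/2"] by auto
  have "r N < r (Suc N)" using r(1) by (simp add: strict_mono_Suc_iff)
  from sep[OF this] N[of N "Suc N"] show False by simp
qed

text \<open>If \<open>R\<close> inverts \<open>T\<close>, then \<open>T + B = (1 + B R) T\<close>, so the Fredholm alternative applies to \<open>B R\<close>.\<close>

lemma compact_inverse_perturbation:
  fixes T B R :: "'a::real_normed_vector \<Rightarrow> 'a"
  assumes R: "compact_map R" "\<And>x. R x \<in> D" "\<And>x. T (R x) = x" "\<And>x. x \<in> D \<Longrightarrow> R (T x) = x"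
    and B: "bounded_linear B"
    and inj: "\<And>x. x \<in> D \<Longrightarrow> T x + B x = 0 \<Longrightarrow> x = 0"
  obtains S where "compact_map S" "\<And>x. S x \<in> D" "\<And>x. T (S x) + B (S x) = x"
    "\<And>x. x \<in> D \<Longrightarrow> S (T x + B x) = x"
proof -
  interpret R: bounded_linear R using R(1) by (rule compact_map_bounded_linear)
  interpret B: bounded_linear B by fact
  define K where "K = (\<lambda>x. B (R x))"
  have K: "compact_map K" unfolding K_def by (rule compact_map_comp_left[OF B R(1)])
  have injK: "x = 0" if "x + K x = 0" for x
  proof -
    have "R x = 0" using inj[of "R x"] that R by (simp add: K_def)
    then show "x = 0" using R(3)[of x] R(3)[of 0] R.zero by metis
  qed
  interpret K: bounded_linear K using K by (rule compact_map_bounded_linear)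
  have inj': "x = y" if "x + K x = y + K y" for x y
    using injK[of "x - y"] that by (simp add: K.diff algebra_simps)
  obtain c where c: "c > 0" "\<And>x. c * norm x \<le> norm (x + K x)"
    using compact_perturbation_bounded_below[OF K injK] by blast
  obtain J where J: "\<And>y. J y + K (J y) = y"
    using compact_perturbation_surj[OF K injK] by (metis surj_def)
  have J': "J (x + K x) = x" for x using J inj' by blast
  \<comment> \<open>Linearity comes from uniqueness of preimages, the bound \<open>1 / c\<close>
    from the lower estimate for \<open>1 + K\<close>.\<close>
  have J_bl: "bounded_linear J"
  proof (rule bounded_linear_intro)
    fix x y r
    have "J x + J y + K (J x + J y) = (J x + K (J x)) + (J y + K (J y))"
      by (simp only: K.add add_ac)
    then show "J (x + y) = J x + J y" by (metis J inj')
    have "r *\<^sub>R J x + K (r *\<^sub>R J x) = r *\<^sub>R (J x + K (J x))"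
      by (simp only: K.scaleR scaleR_right_distrib)
    then show "J (r *\<^sub>R x) = r *\<^sub>R J x" by (metis J inj')
    show "norm (J x) \<le> norm x * (1 / c)"
      using c(2)[of "J x"] c(1) by (simp add: J field_simps)
  qed
  show thesis
  proof
    show "compact_map (\<lambda>x. R (J x))" by (rule compact_map_comp_right[OF R(1) J_bl])
    show "R (J x) \<in> D" for x by (rule R(2))
    show "T (R (J x)) + B (R (J x)) = x" for x using J[of x] by (simp add: R(3) K_def)
    show "R (J (T x + B x)) = x" if "x \<in> D" for x
      using J'[of "T x"] that by (simp add: K_def R(4))
  qed
qed

section \<open>Extremal eigenvectors of compact symmetric operators\<close>

text \<open>Let \<open>M\<close> be the supremum of \<open>norm (K x)\<close> over the unit vectors
  of \<open>Y\<close>. Symmetry makes maximising vectors approximate eigenvectors of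
  \<open>K\<^sup>2\<close> for \<open>M\<^sup>2\<close>, and compactness produces a true one,
  \<open>f\<close>. From \<open>(K - M) (K + M) f = 0\<close> comes an eigenvector of
  \<open>K\<close> for \<open>M\<close> or \<open>- M\<close>. The subspace \<open>Y\<close> will be
  a parity sector.\<close>

lemma compact_symmetric_eigenvector:
  fixes K :: "'a::real_inner \<Rightarrow> 'a"
  assumes K: "compact_map K" and sym: "\<And>x y. x \<in> Y \<Longrightarrow> y \<in> Y \<Longrightarrow> inner (K x) y = inner x (K y)"
    and Y: "subspace Y" "closed Y" "\<And>x. x \<in> Y \<Longrightarrow> K x \<in> Y"
    and u: "u \<in> Y" "u \<noteq> 0"
  obtains f \<mu> where "f \<in> Y" "f \<noteq> 0" "K f = \<mu> *\<^sub>R f" "norm (K u) \<le> \<bar>\<mu>\<bar> * norm u"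
proof -
  interpret bounded_linear K using K by (rule compact_map_bounded_linear)
  define S where "S = {norm (K x) |x. x \<in> Y \<and> norm x = 1}"
  define M where "M = Sup S"
  obtain C where C: "\<And>x. norm (K x) \<le> norm x * C" using bounded by blast
  have "norm (K (u /\<^sub>R norm u)) \<in> S"
    unfolding S_def using u Y(1) by (auto intro!: exI[of _ "u /\<^sub>R norm u"] simp: subspace_scale)
  then have ne: "S \<noteq> {}" by blast
  have bdd: "bdd_above S"
  proof (rule bdd_aboveI)
    fix s assume "s \<in> S"
    then obtain x where "s = norm (K x)" "norm x = 1" by (auto simp: S_def)
    then show "s \<le> C" using C[of x] by simp
  qed
  have le1: "norm (K x) \<le> M" if "x \<in> Y" "norm x = 1" for x
    unfolding M_def by (rule cSup_upper[OF _ bdd]) (use that in \<open>auto simp: S_def\<close>)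
  have le: "norm (K x) \<le> M * norm x" if "x \<in> Y" for x
  proof (cases "x = 0")
    case False
    then have "norm (K (x /\<^sub>R norm x)) \<le> M"
      using that Y(1) by (intro le1) (auto simp: subspace_scale)
    then show ?thesis using False by (simp add: scaleR field_simps)
  qed (simp add: zero)
  have "0 \<le> M * norm u" using le[OF u(1)] norm_ge_zero order_trans by blast
  then have M0: "M \<ge> 0" using u by (simp add: zero_le_mult_iff)
  show thesis
  proof (cases "M = 0")
    case True
    \<comment> \<open>Here \<open>K\<close> vanishes on \<open>Y\<close>, so \<open>u\<close> itself
      is an eigenvector for 0.\<close>
    then show thesis using le[OF u(1)] u that[of u 0] by simp
  next
    case False
    with M0 have Mp: "M > 0" by simp
    have "\<exists>x. x \<in> Y \<and> norm x = 1 \<and> M - 1 / Suc n < norm (K x)" for n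
      using less_cSupD[OF ne, of "M - 1 / Suc n"] by (auto simp: M_def S_def)
    then obtain x where x: "\<And>n. x n \<in> Y" "\<And>n. norm (x n) = 1" "\<And>n. M - 1 / Suc n < norm (K (x n))"
      by metis
    have nK: "(\<lambda>n. norm (K (x n))) \<longlonglongrightarrow> M"
    proof (rule tendsto_sandwich)
      show "(\<lambda>n. M - inverse (real (Suc n))) \<longlonglongrightarrow> M"
        using tendsto_diff[OF tendsto_const LIMSEQ_inverse_real_of_nat] by simp
      show "\<forall>\<^sub>F n in sequentially. M - inverse (real (Suc n)) \<le> norm (K (x n))"
        using x(3) by (auto intro!: always_eventually less_imp_le simp: inverse_eq_divide)
      show "\<forall>\<^sub>F n in sequentially. norm (K (x n)) \<le> M"
        using le1 x by auto
    qed simp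
    \<comment> \<open>Expanding the square and moving one \<open>K\<close> across by symmetry leaves
      a bound that tends to 0 along the maximising sequence.\<close>
    have est: "(norm (K (K (x n)) - M\<^sup>2 *\<^sub>R x n))\<^sup>2 \<le> M\<^sup>2 * (M\<^sup>2 - (norm (K (x n)))\<^sup>2)" for n
    proof -
      let ?y = "K (x n)"
      have "norm (K ?y) \<le> M * norm ?y" using x(1) Y(3) by (intro le) auto
      then have 1: "(norm (K ?y))\<^sup>2 \<le> M\<^sup>2 * (norm ?y)\<^sup>2"
        using power_mono[of "norm (K ?y)" "M * norm ?y" 2] by (simp add: power_mult_distrib)
      have "inner (K ?y) (x n) = (norm ?y)\<^sup>2"
        using sym[of ?y "x n"] x(1) Y(3) by (simp add: power2_norm_eq_inner)
      then have "(norm (K ?y - M\<^sup>2 *\<^sub>R x n))\<^sup>2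
          = (norm (K ?y))\<^sup>2 - 2 * M\<^sup>2 * (norm ?y)\<^sup>2 + M\<^sup>2 * M\<^sup>2 * (norm (x n))\<^sup>2"
        unfolding power2_norm_eq_inner[of "K ?y - M\<^sup>2 *\<^sub>R x n"]
        by (simp add: inner_diff_left inner_diff_right power2_norm_eq_inner inner_commute
            algebra_simps)
      also have "\<dots> \<le> M\<^sup>2 * (M\<^sup>2 - (norm ?y)\<^sup>2)" using 1 by (simp add: x(2) algebra_simps)
      finally show ?thesis .
    qed
    have "(\<lambda>n. M\<^sup>2 * (M\<^sup>2 - (norm (K (x n)))\<^sup>2)) \<longlonglongrightarrow> M\<^sup>2 * (M\<^sup>2 - M\<^sup>2)"
      by (intro tendsto_mult tendsto_diff tendsto_power tendsto_const nK)
    then have lim0: "(\<lambda>n. M\<^sup>2 * (M\<^sup>2 - (norm (K (x n)))\<^sup>2)) \<longlonglongrightarrow> 0" by simp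
    have "(\<lambda>n. (norm (K (K (x n)) - M\<^sup>2 *\<^sub>R x n))\<^sup>2) \<longlonglongrightarrow> 0"
      by (rule Lim_null_comparison[OF _ lim0]) (use est in \<open>simp add: always_eventually\<close>)
    from tendsto_real_sqrt[OF this] have "(\<lambda>n. norm (K (K (x n)) - M\<^sup>2 *\<^sub>R x n)) \<longlonglongrightarrow> 0"
      by simp
    then have diff0: "(\<lambda>n. K (K (x n)) - M\<^sup>2 *\<^sub>R x n) \<longlonglongrightarrow> 0"
      by (rule tendsto_norm_zero_cancel)
    \<comment> \<open>\<open>M\<^sup>2 *\<^sub>R x n\<close> differs from \<open>K (K (x n))\<close>
      by a null sequence, so convergence of the latter along a subsequence yields a limit of
      \<open>x n\<close> in the space.\<close>
    obtain r l where r: "strict_mono r" "(\<lambda>n. K (K (x (r n)))) \<longlonglongrightarrow> l"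
      using compact_mapE[OF compact_map_comp_left[OF bounded_linear_axioms K], of x 1] x(2) by auto
    have d: "(\<lambda>n. K (K (x (r n))) - M\<^sup>2 *\<^sub>R x (r n)) \<longlonglongrightarrow> 0"
      using LIMSEQ_subseq_LIMSEQ[OF diff0 r(1)] by (simp add: o_def)
    from tendsto_diff[OF r(2) this] have "(\<lambda>n. M\<^sup>2 *\<^sub>R x (r n)) \<longlonglongrightarrow> l" by simp
    from tendsto_scaleR[OF tendsto_const[of "inverse (M\<^sup>2)"] this]
    have xr: "(\<lambda>n. x (r n)) \<longlonglongrightarrow> l /\<^sub>R M\<^sup>2" using Mp by simp
    define f where "f = l /\<^sub>R M\<^sup>2"
    note xr = xr[folded f_def]
    have f: "f \<in> Y" using closed_sequentially[OF Y(2) _ xr] x(1) by blast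
    have "norm f = 1" using tendsto_norm[OF xr] x(2) by (simp add: LIMSEQ_const_iff)
    then have f0: "f \<noteq> 0" by auto
    have KK: "K (K f) = M\<^sup>2 *\<^sub>R f"
    proof -
      have "(\<lambda>n. K (K (x (r n))) - M\<^sup>2 *\<^sub>R x (r n)) \<longlonglongrightarrow> K (K f) - M\<^sup>2 *\<^sub>R f"
        by (intro tendsto_diff tendsto_scaleR tendsto_const tendsto xr)
      from LIMSEQ_unique[OF this d] have "K (K f) - M\<^sup>2 *\<^sub>R f = 0" .
      then show ?thesis by simp
    qed
    define h where "h = K f + M *\<^sub>R f"
    show thesis
    proof (cases "h = 0")
      case True
      then have "K f = (- M) *\<^sub>R f" by (simp add: h_def eq_neg_iff_add_eq_0)
      then show thesis using that[OF f f0, of "- M"] le[OF u(1)] Mp by simp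
    next
      case False
      have "K h = M *\<^sub>R h"
        by (simp add: h_def add scaleR KK scaleR_right_distrib power2_eq_square)
      moreover have "h \<in> Y" using f Y by (simp add: h_def subspace_add subspace_scale)
      ultimately show thesis using that[of h M] False le[OF u(1)] Mp by simp
    qed
  qed
qed


section \<open>Operators on square-integrable functions\<close>

lemma cinner_add_right: "cinner a (b + c) = cinner a b + cinner a c"
  using cinner_add_left[of b c a] cinner_commute[of a "b + c"] cinner_commute[of a b]
    cinner_commute[of a c] by simp

lemma cinner_scaleC_right: "cinner a (z *\<^sub>C b) = z * cinner a b"
  using cinner_scaleC_left[of z b a] cinner_commute[of a "z *\<^sub>C b"] cinner_commute[of a b]
  by simp

lemma cinner_self_norm: "cinner a a = complex_of_real ((norm a)\<^sup>2)"
  by (auto simp: complex_eq_iff power2_norm_eq_inner inner_L2_def cinner_self)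

lemma scaleC_scaleC: "z *\<^sub>C w *\<^sub>C a = (z * w) *\<^sub>C a"
  by transfer (auto simp: L2_rel_def mult.assoc intro!: sq_integrable_scale)

lemma scaleC_add_right: "z *\<^sub>C (a + b) = z *\<^sub>C a + z *\<^sub>C b"
  by transfer (auto simp: L2_rel_def distrib_left intro!: sq_integrable_add sq_integrable_scale)

lemma scaleC_add_left: "(z + w) *\<^sub>C a = z *\<^sub>C a + w *\<^sub>C a"
  by transfer (auto simp: L2_rel_def distrib_right intro!: sq_integrable_add sq_integrable_scale)

lemma scaleC_of_real: "complex_of_real r *\<^sub>C a = r *\<^sub>R a"
  by (simp add: scaleR_L2_def)

lemma scaleC_minus_left: "(- z) *\<^sub>C a = - (z *\<^sub>C a)"
  by (simp add: uminus_L2_def scaleC_scaleC)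

lemma scaleC_diff_left: "(z - w) *\<^sub>C a = z *\<^sub>C a - w *\<^sub>C a"
  using scaleC_add_left[of z "- w" a] by (simp add: scaleC_minus_left)

lemma scaleC_scaleR: "z *\<^sub>C r *\<^sub>R a = r *\<^sub>R z *\<^sub>C a"
  by (simp add: scaleR_L2_def scaleC_scaleC mult.commute)

lemma norm_scaleC: "norm (z *\<^sub>C a) = cmod z * norm a"
proof -
  have "complex_of_real ((norm (z *\<^sub>C a))\<^sup>2) = (cnj z * z) * complex_of_real ((norm a)\<^sup>2)"
    unfolding cinner_self_norm[symmetric] by (simp add: cinner_scaleC_left cinner_scaleC_right)
  also have "cnj z * z = complex_of_real ((cmod z)\<^sup>2)"
    by (metis complex_norm_square mult.commute)
  also have "\<dots> * complex_of_real ((norm a)\<^sup>2) = complex_of_real ((cmod z * norm a)\<^sup>2)"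
    by (simp add: power_mult_distrib)
  finally have "(norm (z *\<^sub>C a))\<^sup>2 = (cmod z * norm a)\<^sup>2" by (simp only: of_real_eq_iff)
  then show ?thesis by (simp add: power2_eq_iff_nonneg)
qed

lemma bounded_linear_scaleC: "bounded_linear (\<lambda>a. z *\<^sub>C a)"
  by (rule bounded_linear_intro[where K = "cmod z"])
    (simp_all add: scaleC_add_right scaleC_scaleR norm_scaleC)

section \<open>Parity as a linear isometry\<close>

lemma parity_add: "parity (a + b) = parity a + parity b"
  by transfer (auto simp: L2_rel_def intro!: sq_integrable_add sq_integrable_uminus)

lemma parity_scaleC: "parity (z *\<^sub>C a) = z *\<^sub>C parity a"
  by transfer (auto simp: L2_rel_def intro!: sq_integrable_scale sq_integrable_uminus)

lemma parity_scaleR: "parity (r *\<^sub>R a) = r *\<^sub>R parity a"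
  by (simp add: scaleR_L2_def parity_scaleC)

lemma parity_parity: "parity (parity a) = a"
  by transfer (auto simp: L2_rel_def)

text \<open>Lebesgue measure is invariant under reflection, so the substitution of
  \<open>- x\<close> for \<open>x\<close> leaves the integral of the squared modulus
  unchanged.\<close>

lemma norm_parity:
  fixes a :: "'a::euclidean_space L2"
  shows "norm (parity a) = norm a"
proof -
  have "cinner (parity a) (parity a) = cinner a a"
  proof transfer
    fix f :: "'a \<Rightarrow> complex"
    assume "L2_rel f f"
    then have "sq_integrable f" by (simp add: L2_rel_def)
    then have "(\<lambda>x. cnj (f x) * f x) \<in> borel_measurable lebesgue"
      by (intro borel_measurable_integrable sq_integrable_prod)
    from integral_distr[OF uminus_lebesgue_measurable this]
    show "(\<integral>x. cnj (f (- x)) * f (- x) \<partial>lebesgue) = (\<integral>x. cnj (f x) * f x \<partial>lebesgue)"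
      by (simp add: lebesgue_distr_uminus)
  qed
  then have "(norm (parity a))\<^sup>2 = (norm a)\<^sup>2" by (simp only: cinner_self_norm of_real_eq_iff)
  then show ?thesis by (simp add: power2_eq_iff_nonneg)
qed

lemma bounded_linear_parity: "bounded_linear parity"
  by (rule bounded_linear_intro[where K = 1])
    (simp_all add: parity_add parity_scaleR norm_parity)

section \<open>Multiplication by bounded functions\<close>

lemma mult_op_add: "mult_op V (a + b) = mult_op V a + mult_op V b"
  by (cases "in_Linf V"; transfer)
    (auto simp: L2_rel_def distrib_left sq_integrable_zero
      intro!: sq_integrable_add sq_integrable_Linf_mult sq_integrable_scale)

lemma mult_op_scaleC: "mult_op V (z *\<^sub>C a) = z *\<^sub>C mult_op V a"
  by (cases "in_Linf V"; transfer)
    (auto simp: L2_rel_def sq_integrable_zero mult.left_commute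
      intro!: sq_integrable_scale sq_integrable_Linf_mult)

lemma norm_mult_op:
  fixes a :: "'a::euclidean_space L2"
  assumes V: "in_Linf V" and B: "AE x in lebesgue. norm (V x) \<le> B" "0 \<le> B"
  shows "norm (mult_op V a) \<le> B * norm a"
proof -
  have "Re (cinner (mult_op V a) (mult_op V a)) \<le> B\<^sup>2 * Re (cinner a a)"
    using V B
  proof (transfer fixing: V B)
    fix f :: "'a \<Rightarrow> complex"
    assume "L2_rel f f" and V: "in_Linf V" and B: "AE x in lebesgue. norm (V x) \<le> B" "0 \<le> B"
    then have f: "sq_integrable f" by (simp add: L2_rel_def)
    note Vf = sq_integrable_Linf_mult[OF V f]
    have eq: "cnj z * z = complex_of_real ((cmod z)\<^sup>2)" for z
      by (metis complex_norm_square mult.commute)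
    have "(\<integral>x. (cmod (V x * f x))\<^sup>2 \<partial>lebesgue) \<le> (\<integral>x. B\<^sup>2 * (cmod (f x))\<^sup>2 \<partial>lebesgue)"
    proof (rule integral_mono_AE)
      show "AE x in lebesgue. (cmod (V x * f x))\<^sup>2 \<le> B\<^sup>2 * (cmod (f x))\<^sup>2"
        using B(1) by eventually_elim
          (auto simp: norm_mult power_mult_distrib intro!: mult_right_mono power_mono)
    qed (use f Vf in \<open>auto simp: sq_integrable_def\<close>)
    then show "Re (\<integral>x. cnj (if in_Linf V then V x * f x else 0) *
        (if in_Linf V then V x * f x else 0) \<partial>lebesgue) \<le> B\<^sup>2 * Re (\<integral>x. cnj (f x) * f x \<partial>lebesgue)"
      by (simp only: V if_True eq integral_complex_of_real Re_complex_of_real integral_mult_right_zero)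
  qed
  then have "(norm (mult_op V a))\<^sup>2 \<le> (B * norm a)\<^sup>2"
    by (simp add: cinner_self_norm power_mult_distrib)
  then show ?thesis using B(2) by (simp add: power2_le_iff_abs_le)
qed

lemma cinner_mult_op_imaginary:
  assumes V: "in_Linf V" and im: "\<And>x. cnj (V x) = - V x"
  shows "cinner (mult_op V a) b = - cinner a (mult_op V b)"
  using assms by (transfer fixing: V) (simp add: mult_ac)

lemma parity_mult_op_odd:
  fixes V :: "'a::euclidean_space \<Rightarrow> complex"
  assumes V: "in_Linf V" and odd: "AE x in lebesgue. V (- x) = - V x"
  shows "parity (mult_op V a) = - mult_op V (parity a)"
  unfolding uminus_L2_def using assms
proof (transfer fixing: V)
  fix f :: "'a \<Rightarrow> complex"
  assume "L2_rel f f" and V: "in_Linf V" and odd: "AE x in lebesgue. V (- x) = - V x"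
  then have f: "sq_integrable f" by (simp add: L2_rel_def)
  show "L2_rel (\<lambda>x. if in_Linf V then V (- x) * f (- x) else 0)
      (\<lambda>x. - 1 * (if in_Linf V then V x * f (- x) else 0))"
    unfolding L2_rel_def
  proof (intro conjI)
    show "sq_integrable (\<lambda>x. if in_Linf V then V (- x) * f (- x) else 0)"
      using sq_integrable_uminus[OF sq_integrable_Linf_mult[OF V f]] V by simp
    show "sq_integrable (\<lambda>x. - 1 * (if in_Linf V then V x * f (- x) else 0))"
      using sq_integrable_scale[OF sq_integrable_Linf_mult[OF V sq_integrable_uminus[OF f]], of "- 1"] V
      by simp
    show "AE x in lebesgue. (if in_Linf V then V (- x) * f (- x) else 0)
        = - 1 * (if in_Linf V then V x * f (- x) else 0)"
      using odd by eventually_elim (simp add: V)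
  qed
qed

lemma in_Linf_imaginary:
  fixes W :: "'a::euclidean_space \<Rightarrow> real"
  assumes "in_Linf W"
  shows "in_Linf (\<lambda>x. \<i> * complex_of_real (W x))"
proof -
  have "(\<lambda>x. \<i> * complex_of_real (W x)) \<in> borel_measurable lebesgue"
    using assms by (auto simp: in_Linf_def intro!: borel_measurable_times borel_measurable_of_real)
  then show ?thesis using assms by (simp add: in_Linf_def Linf_norm_def norm_mult)
qed

text \<open>Taking \<open>max 0\<close> gives the nonnegative real bound that
  \<open>norm_mult_op\<close> asks for, without a separate proof that the essential supremum is
  nonnegative.\<close>

lemma AE_norm_le_Linf_norm:
  assumes "in_Linf V"
  shows "AE x in lebesgue. norm (V x) \<le> max 0 (real_of_ereal (Linf_norm V))"
proof -
  have "AE x in lebesgue. ereal (norm (V x)) \<le> Linf_norm V"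
    unfolding Linf_norm_def by (rule esssup_AE)
  then show ?thesis
  proof eventually_elim
    case (elim x)
    with assms show ?case by (cases "Linf_norm V") (auto simp: in_Linf_def)
  qed
qed

text \<open>For norm 0 the quotient is infinite and says nothing about \<open>c\<close>, but then
  the product is 0 and \<open>d\<close> is positive. For positive norm the denominator is
  cleared.\<close>

lemma less_divide_Linf_norm:
  assumes "ereal c < ereal d / Linf_norm V" "in_Linf V" "d > 0"
  shows "c * max 0 (real_of_ereal (Linf_norm V)) < d"
  using assms by (cases "Linf_norm V") (auto simp: in_Linf_def max_def field_simps split: if_splits)

section \<open>Perturbation of operators with compact resolvent\<close>

text \<open>This passes from \<open>inv_into\<close> to a two-sided inverse \<open>R\<close> between
  \<open>D\<close> and the whole space, and from compact closures of images to the sequential form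
  of compactness.\<close>

lemma compact_resolvent_inverse:
  assumes "compact_resolvent D A"
  obtains z R where "compact_map R" "\<And>x. R x \<in> D" "\<And>x. A (R x) - z *\<^sub>C R x = x"
    "\<And>x. x \<in> D \<Longrightarrow> R (A x - z *\<^sub>C x) = x"
proof -
  obtain z where z: "z \<in> resolvent_set D A" and R: "compact_operator (resolvent D A z)"
    using assms by (auto simp: compact_resolvent_def)
  have bij: "bij_betw (\<lambda>\<psi>. A \<psi> - z *\<^sub>C \<psi>) D UNIV" and bl: "bounded_linear (resolvent D A z)"
    using z by (auto simp: resolvent_set_def)
  have inv: "resolvent D A z x \<in> D" "A (resolvent D A z x) - z *\<^sub>C resolvent D A z x = x" for x
    using bij inv_into_into[of x "\<lambda>\<psi>. A \<psi> - z *\<^sub>C \<psi>" D]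
      f_inv_into_f[of x "\<lambda>\<psi>. A \<psi> - z *\<^sub>C \<psi>" D]
    by (auto simp: resolvent_def bij_betw_def)
  have inv': "resolvent D A z (A x - z *\<^sub>C x) = x" if "x \<in> D" for x
    using bij_betw_inv_into_left[OF bij that] by (simp add: resolvent_def)
  have "compact_map (resolvent D A z)"
    unfolding compact_map_def
  proof (intro conjI bl allI impI)
    fix x :: "nat \<Rightarrow> 'a L2" assume "bounded (range x)"
    then have "seq_compact (closure (resolvent D A z ` range x))"
      using R by (intro compact_imp_seq_compact) (simp add: compact_operator_def)
    moreover have "\<forall>n. resolvent D A z (x n) \<in> closure (resolvent D A z ` range x)"
      by (meson closure_subset image_eqI rangeI subsetD)
    ultimately obtain l r where "strict_mono (r :: nat \<Rightarrow> nat)"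
      "((\<lambda>n. resolvent D A z (x n)) \<circ> r) \<longlonglongrightarrow> l"
      by (rule seq_compactE)
    then show "\<exists>r l. strict_mono r \<and> (\<lambda>n. resolvent D A z (x (r n))) \<longlonglongrightarrow> l"
      unfolding o_def by blast
  qed
  from that[OF this inv inv'] show thesis .
qed

text \<open>The Fredholm alternative for \<open>A + B\<close>, used below both for
  \<open>A - a\<close> with real \<open>a\<close> and for \<open>H(g) - E\<close>. The point
  \<open>z\<close> whose resolvent is known to be compact is absorbed by writing
  \<open>A + B = (A - z) + (z + B)\<close>.\<close>

lemma compact_resolvent_perturbation:
  assumes "compact_resolvent D A" and B: "bounded_linear B"
    and inj: "\<And>x. x \<in> D \<Longrightarrow> A x + B x = 0 \<Longrightarrow> x = 0"
  obtains S where "compact_map S" "\<And>x. S x \<in> D" "\<And>x. A (S x) + B (S x) = x"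
    "\<And>x. x \<in> D \<Longrightarrow> S (A x + B x) = x"
proof -
  obtain z R where R: "compact_map R" "\<And>x. R x \<in> D" "\<And>x. A (R x) - z *\<^sub>C R x = x"
    "\<And>x. x \<in> D \<Longrightarrow> R (A x - z *\<^sub>C x) = x"
    using compact_resolvent_inverse[OF assms(1)] by metis
  have eq: "A x - z *\<^sub>C x + (z *\<^sub>C x + B x) = A x + B x" for x by simp
  have bl: "bounded_linear (\<lambda>x. z *\<^sub>C x + B x)"
    by (rule bounded_linear_add[OF bounded_linear_scaleC B])
  show thesis
    by (rule compact_inverse_perturbation[of R D "\<lambda>x. A x - z *\<^sub>C x", OF R bl])
      (simp_all only: eq inj that)
qed

section \<open>Eigenvalues of given parity near a real point\<close>

lemma linear_operator_add:
  "linear_operator D A \<Longrightarrow> x \<in> D \<Longrightarrow> y \<in> D \<Longrightarrow> x + y \<in> D"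
  "linear_operator D A \<Longrightarrow> x \<in> D \<Longrightarrow> y \<in> D \<Longrightarrow> A (x + y) = A x + A y"
  by (auto simp: linear_operator_def)

lemma linear_operator_scaleC:
  "linear_operator D A \<Longrightarrow> x \<in> D \<Longrightarrow> z *\<^sub>C x \<in> D"
  "linear_operator D A \<Longrightarrow> x \<in> D \<Longrightarrow> A (z *\<^sub>C x) = z *\<^sub>C A x"
  by (auto simp: linear_operator_def)

lemma linear_operator_diff:
  assumes "linear_operator D A" "x \<in> D" "y \<in> D"
  shows "x - y \<in> D" "A (x - y) = A x - A y"
  using linear_operator_add[OF assms(1,2), of "(- 1) *\<^sub>C y"]
    linear_operator_scaleC[OF assms(1,3), of "- 1"]
  by (simp_all add: minus_L2_def uminus_L2_def)

lemma self_adjoint_symmetric: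
  assumes "self_adjoint D A" "x \<in> D" "y \<in> D"
  shows "cinner x (A y) = cinner (A x) y"
proof -
  have "(x, A x) \<in> adjoint_graph D A"
    using assms by (auto simp: self_adjoint_def op_graph_def)
  then show ?thesis using assms(3) by (simp add: adjoint_graph_def)
qed

text \<open>The inverse \<open>K\<close> of \<open>T = A - a\<close> is compact, symmetric and
  preserves parity. Its extremal eigenvalue \<open>\<mu>\<close> on the parity sector satisfies
  \<open>norm u \<le> \<bar>\<mu>\<bar> * norm (T u) \<le> \<bar>\<mu>\<bar> * c * norm u\<close>,
  so \<open>a + inverse \<mu>\<close> is an eigenvalue of \<open>A\<close> within \<open>c\<close>
  of \<open>a\<close>.\<close>

lemma eigenvalue_near_regular:
  fixes D :: "'a::euclidean_space L2 set"
  assumes A: "self_adjoint D A" "compact_resolvent D A" "P_symmetric D A"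
    and a: "complex_of_real a \<notin> eigenvalues D A"
    and u: "u \<in> D" "parity u = s *\<^sub>R u" "u \<noteq> 0" "norm (A u - a *\<^sub>R u) \<le> c * norm u"
  shows "\<exists>b f. \<bar>b - a\<bar> \<le> c \<and> f \<noteq> 0 \<and> f \<in> eigenspace D A (complex_of_real b) \<and> parity f = s *\<^sub>R f"
proof -
  have lin: "linear_operator D A" using A(1) by (simp add: self_adjoint_def)
  define T where "T x = A x + (- a) *\<^sub>R x" for x
  have "x = 0" if "x \<in> D" "A x + (- a) *\<^sub>R x = 0" for x
    using a that by (auto simp: eigenvalues_def eigenspace_def scaleC_of_real)
  from compact_resolvent_perturbation[OF A(2) bounded_linear_scaleR_right this]
  obtain K where K: "compact_map K" "\<And>x. K x \<in> D" "\<And>x. T (K x) = x" "\<And>x. x \<in> D \<Longrightarrow> K (T x) = x"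
    unfolding T_def by metis
  interpret P: bounded_linear "parity :: 'a L2 \<Rightarrow> 'a L2" by (rule bounded_linear_parity)
  interpret K: bounded_linear K using K(1) by (rule compact_map_bounded_linear)
  \<comment> \<open>Searching for the eigenvector inside \<open>Y\<close> is what forces it to have
    the parity of \<open>u\<close>.\<close>
  define Y :: "'a L2 set" where "Y = {f. parity f = s *\<^sub>R f}"
  have Y: "subspace Y" "closed Y"
  proof -
    show "subspace Y"
      by (auto simp: subspace_def Y_def P.zero P.add P.scaleR scaleR_right_distrib)
    show "closed Y"
      unfolding Y_def
      by (intro closed_Collect_eq linear_continuous_on bounded_linear_parity bounded_linear_scaleR_right)
  qed
  have Tpar: "T (parity x) = parity (T x)" "parity x \<in> D" if "x \<in> D" for x
    using A(3) that by (auto simp: P_symmetric_def T_def P.diff P.scaleR)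
  have KY: "K f \<in> Y" if "f \<in> Y" for f
  proof -
    have "parity (K f) = K (T (parity (K f)))" using K(2,4) Tpar(2) by metis
    also have "\<dots> = K (parity f)" using Tpar(1) K(2,3) by metis
    also have "\<dots> = s *\<^sub>R K f" using that by (simp add: Y_def K.scaleR)
    finally show ?thesis by (simp add: Y_def)
  qed
  have Tsym: "inner x (T y) = inner (T x) y" if "x \<in> D" "y \<in> D" for x y
  proof -
    have "inner x (A y) = inner (A x) y"
      using self_adjoint_symmetric[OF A(1) that] by (simp add: inner_L2_def)
    then show ?thesis by (simp add: T_def inner_diff_left inner_diff_right)
  qed
  have sym: "inner (K x) y = inner x (K y)" for x y
    using Tsym[of "K x" "K y"] K(2,3) by simp
  have As: "A (r *\<^sub>R x) = r *\<^sub>R A x" if "x \<in> D" for r x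
    using linear_operator_scaleC(2)[OF lin that] by (simp add: scaleR_L2_def)
  have Ts: "T (r *\<^sub>R x) = r *\<^sub>R T x" if "x \<in> D" for r x
    by (simp add: T_def As[OF that] scaleR_right_diff_distrib mult.commute)
  have TuY: "T u \<in> Y"
    using Tpar(1)[OF u(1)] u(2) Ts[OF u(1)] by (simp add: Y_def)
  have Tu0: "T u \<noteq> 0" using K(4)[OF u(1)] u(3) K.zero by auto
  \<comment> \<open>The vector fed in is \<open>T u\<close>: as \<open>K (T u) = u\<close>, the norm
    estimate becomes a lower bound on \<open>\<bar>\<mu>\<bar>\<close>.\<close>
  obtain f \<mu> where f: "f \<in> Y" "f \<noteq> 0" "K f = \<mu> *\<^sub>R f" and \<mu>: "norm (K (T u)) \<le> \<bar>\<mu>\<bar> * norm (T u)"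
    using compact_symmetric_eigenvector[OF K(1) sym Y KY TuY Tu0] by blast
  \<comment> \<open>\<open>K\<close> is injective, being undone by \<open>T\<close>. A nonzero
    \<open>\<mu>\<close> also puts \<open>f\<close>, a multiple of \<open>K f\<close>, into
    \<open>D\<close>.\<close>
  have \<mu>0: "\<mu> \<noteq> 0"
  proof
    assume "\<mu> = 0"
    then have "K f = 0" using f by simp
    moreover have "T 0 = 0" using Ts[OF u(1), of 0] by simp
    ultimately show False using K(3)[of f] f(2) by simp
  qed
  have fD: "f \<in> D"
  proof -
    have "f = complex_of_real (inverse \<mu>) *\<^sub>C K f"
      using f \<mu>0 by (simp only: scaleC_of_real) simp
    then show ?thesis using linear_operator_scaleC(1)[OF lin K(2)] by metis
  qed
  have "A f = (a + inverse \<mu>) *\<^sub>R f"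
  proof -
    have "f = T (\<mu> *\<^sub>R f)" using K(3)[of f] f by simp
    also have "\<dots> = \<mu> *\<^sub>R T f"
      by (rule Ts[OF fD])
    finally have "inverse \<mu> *\<^sub>R f = inverse \<mu> *\<^sub>R \<mu> *\<^sub>R T f" by simp
    then have "T f = inverse \<mu> *\<^sub>R f" using \<mu>0 by simp
    then show ?thesis by (simp add: T_def algebra_simps)
  qed
  then have "f \<in> eigenspace D A (complex_of_real (a + inverse \<mu>))"
    using fD by (simp only: eigenspace_def scaleC_of_real) simp
  moreover have "\<bar>a + inverse \<mu> - a\<bar> \<le> c"
  proof -
    have "norm u \<le> \<bar>\<mu>\<bar> * norm (T u)" using \<mu> K(4)[OF u(1)] by simp
    also have "\<dots> \<le> \<bar>\<mu>\<bar> * (c * norm u)"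
      using u(4) by (intro mult_left_mono) (simp_all add: T_def)
    finally have "1 * norm u \<le> (\<bar>\<mu>\<bar> * c) * norm u" by (simp add: mult.assoc)
    then have "1 \<le> \<bar>\<mu>\<bar> * c" using u(3) by (simp only: mult_le_cancel_right) auto
    then show ?thesis using \<mu>0 by (simp add: abs_inverse field_simps)
  qed
  moreover have "parity f = s *\<^sub>R f" using f(1) by (simp add: Y_def)
  ultimately show ?thesis using f(2) by blast
qed

text \<open>A slight shift of \<open>a\<close> avoids the countably many eigenvalues.\<close>

lemma eigenvalue_near:
  fixes D :: "'a::euclidean_space L2 set"
  assumes A: "self_adjoint D A" "compact_resolvent D A" "P_symmetric D A"
    and cnt: "countable (eigenvalues D A)"
    and u: "u \<in> D" "parity u = s *\<^sub>R u" "u \<noteq> 0" "norm (A u - a *\<^sub>R u) \<le> c * norm u"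
    and cd: "c < d"
  shows "\<exists>b f. \<bar>b - a\<bar> < d \<and> f \<noteq> 0 \<and> f \<in> eigenspace D A (complex_of_real b) \<and> parity f = s *\<^sub>R f"
proof -
  define N where "N = {x. complex_of_real x \<in> eigenvalues D A}"
  have "countable (complex_of_real ` N)"
    by (rule countable_subset[OF _ cnt]) (auto simp: N_def)
  then have "countable N" by (rule countable_image_inj_on) (simp add: inj_on_def)
  moreover have "uncountable {a<..<a + (d - c) / 2}"
    using cd by (simp add: uncountable_open_interval)
  ultimately have "\<not> {a<..<a + (d - c) / 2} \<subseteq> N" using countable_subset by blast
  then obtain a' where a': "a < a'" "a' < a + (d - c) / 2" "complex_of_real a' \<notin> eigenvalues D A"
    by (auto simp: N_def subset_iff)
  have "norm (A u - a' *\<^sub>R u) \<le> norm (A u - a *\<^sub>R u) + norm ((a' - a) *\<^sub>R u)"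
    using norm_triangle_ineq4[of "A u - a *\<^sub>R u" "(a' - a) *\<^sub>R u"] by (simp add: algebra_simps)
  also have "\<dots> \<le> (c + (a' - a)) * norm u"
    using u(4) a'(1) by (simp add: distrib_right)
  finally obtain b f where "\<bar>b - a'\<bar> \<le> c + (a' - a)" "f \<noteq> 0"
    "f \<in> eigenspace D A (complex_of_real b)" "parity f = s *\<^sub>R f"
    using eigenvalue_near_regular[OF A a'(3) u(1-3)] by blast
  \<comment> \<open>The shift is paid for twice, in the residual of \<open>u\<close> and in the
    distance of \<open>b\<close>; hence the choice of \<open>a'\<close> within
    \<open>(d - c) / 2\<close> of \<open>a\<close>.\<close>
  moreover from this(1) a'(1,2) have "\<bar>b - a\<bar> < d" by (simp add: field_simps)
  ultimately show ?thesis by blast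
qed

section \<open>Excluding non-real eigenvalues\<close>

text \<open>Pythagoras: \<open>A u - E *\<^sub>C u\<close> is the sum of
  \<open>w = A u - Re E *\<^sub>R u\<close> and an imaginary multiple \<open>y\<close> of
  \<open>u\<close>. These are orthogonal for the real inner product, because
  \<open>cinner w u\<close> is real by symmetry of \<open>A\<close>.\<close>

lemma real_shift_norm_le:
  assumes A: "self_adjoint D A" and u: "u \<in> D"
  shows "norm (A u - Re E *\<^sub>R u) \<le> norm (A u - E *\<^sub>C u)"
proof -
  define w where "w = A u - Re E *\<^sub>R u"
  define y where "y = (- \<i> * Im E) *\<^sub>C u"
  have "E = of_real (Re E) - (- \<i> * Im E)" by (simp add: complex_eq_iff)
  then have "E *\<^sub>C u = Re E *\<^sub>R u - y"
    unfolding y_def scaleC_of_real[symmetric] scaleC_diff_left[symmetric] by simp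
  then have eq: "A u - E *\<^sub>C u = w + y" by (simp add: w_def)
  have "cinner u w = cinner w u"
  proof -
    have "w = A u + complex_of_real (- Re E) *\<^sub>C u"
      unfolding scaleC_of_real by (simp add: w_def)
    then show ?thesis
      using self_adjoint_symmetric[OF A u u]
      by (simp add: cinner_add_left cinner_add_right cinner_scaleC_left cinner_scaleC_right)
  qed
  then have "Im (cinner w u) = 0" using cinner_commute[of w u] by (simp add: complex_eq_iff)
  then have "inner w y = 0" by (simp add: inner_L2_def y_def cinner_scaleC_right)
  then have "(norm (w + y))\<^sup>2 = (norm w)\<^sup>2 + (norm y)\<^sup>2"
    by (simp add: power2_norm_eq_inner inner_add_left inner_add_right inner_commute)
  then have "(norm w)\<^sup>2 \<le> (norm (w + y))\<^sup>2" by simp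
  then show ?thesis unfolding eq w_def[symmetric] by (rule power2_le_imp_le) simp
qed

text \<open>Here \<open>V\<close> already contains the factor \<open>g\<close>. The gap and the
  definite parity of the eigenvalues enter through \<open>sep\<close>, with \<open>d\<close> half
  the gap.\<close>

lemma PT_nonreal_not_eigenvalue:
  fixes D :: "'a::euclidean_space L2 set"
  assumes A: "self_adjoint D A" "compact_resolvent D A" "P_symmetric D A"
    and cnt: "countable (eigenvalues D A)"
    and V: "bounded_linear V" "\<And>x y. cinner (V x) y = - cinner x (V y)"
      "\<And>x. parity (V x) = - V (parity x)" "\<And>x. norm (V x) \<le> c * norm x"
    and cd: "c < d"
    and sep: "\<And>b b' f f'. parity f = f \<Longrightarrow> parity f' = - f' \<Longrightarrow> f \<noteq> 0 \<Longrightarrow> f' \<noteq> 0 \<Longrightarrow>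
       f \<in> eigenspace D A (complex_of_real b) \<Longrightarrow> f' \<in> eigenspace D A (complex_of_real b') \<Longrightarrow>
       2 * d \<le> \<bar>b - b'\<bar>"
    and E: "E \<notin> \<real>"
    and \<psi>: "\<psi> \<in> D" "A \<psi> + V \<psi> = E *\<^sub>C \<psi>"
  shows "\<psi> = 0"
proof (rule ccontr)
  assume nz: "\<psi> \<noteq> 0"
  have lin: "linear_operator D A" using A(1) by (simp add: self_adjoint_def)
  interpret V: bounded_linear V by fact
  interpret P: bounded_linear "parity :: 'a L2 \<Rightarrow> 'a L2" by (rule bounded_linear_parity)
  interpret sE: bounded_linear "\<lambda>x. E *\<^sub>C x" by (rule bounded_linear_scaleC)
  \<comment> \<open>These are twice the even and odd parts; the equations are homogeneous, so the
    factor is harmless.\<close>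
  define u v where "u = \<psi> + parity \<psi>" and "v = \<psi> - parity \<psi>"
  have P\<psi>: "parity \<psi> \<in> D" "A (parity \<psi>) = parity (A \<psi>)"
    using A(3) \<psi>(1) by (auto simp: P_symmetric_def)
  have D: "u \<in> D" "v \<in> D" and Au: "A u = A \<psi> + A (parity \<psi>)" and Av: "A v = A \<psi> - A (parity \<psi>)"
    using linear_operator_add[OF lin \<psi>(1) P\<psi>(1)] linear_operator_diff[OF lin \<psi>(1) P\<psi>(1)]
    by (simp_all add: u_def v_def)
  have pu: "parity u = u" and pv: "parity v = - v"
    by (simp_all add: u_def v_def P.add P.diff parity_parity add.commute)
  have "parity (A \<psi> + V \<psi>) = parity (E *\<^sub>C \<psi>)" by (simp only: \<psi>(2))
  \<comment> \<open>Reflecting the eigenvalue equation flips the sign of \<open>V\<close>; the sum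
    and the difference of the two equations couple \<open>u\<close> with \<open>v\<close>.\<close>
  then have *: "A (parity \<psi>) - V (parity \<psi>) = E *\<^sub>C parity \<psi>"
    by (simp add: P.add P\<psi>(2) V(3) parity_scaleC)
  have eu: "E *\<^sub>C u = A u + V v" and ev: "E *\<^sub>C v = A v + V u"
    unfolding Au Av by (simp_all add: u_def v_def sE.add sE.diff V.add V.diff \<psi>(2)[symmetric] *[symmetric])
  have Im_form: "Im (cinner x (A x)) = 0" if "x \<in> D" for x
    using self_adjoint_symmetric[OF A(1) that that] cinner_commute[of "A x" x]
    by (simp add: complex_eq_iff)
  \<comment> \<open>The quadratic form of \<open>A\<close> is real, so pairing the coupled equation
    with \<open>x\<close> leaves only the \<open>V\<close> term in the imaginary part.\<close>
  have im: "Im E * (norm x)\<^sup>2 = Im (cinner x (V y))" if "x \<in> D" "E *\<^sub>C x = A x + V y" for x y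
  proof -
    have "E * cinner x x = cinner x (A x) + cinner x (V y)"
      by (simp only: cinner_scaleC_right[symmetric] that(2) cinner_add_right)
    then have "Im (E * complex_of_real ((norm x)\<^sup>2)) = Im (cinner x (V y))"
      using Im_form[OF that(1)] unfolding cinner_self_norm by simp
    then show ?thesis by simp
  qed
  \<comment> \<open>Skew-adjointness turns one form into minus the conjugate of the other, which
    preserves the imaginary part.\<close>
  have "cinner v (V u) = - cnj (cinner u (V v))"
    by (simp only: cinner_commute[of v "V u"] V(2)) simp
  then have "Im (cinner v (V u)) = Im (cinner u (V v))" by simp
  then have "Im E * (norm u)\<^sup>2 = Im E * (norm v)\<^sup>2" using im[OF D(1) eu] im[OF D(2) ev] by simp
  moreover have "Im E \<noteq> 0" using E by (simp add: complex_is_Real_iff)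
  ultimately have uv: "norm u = norm v" by (simp add: power2_eq_iff_nonneg)
  \<comment> \<open>By equality of the norms, if one of \<open>u\<close>, \<open>v\<close> vanished
    both would, and then so would \<open>\<psi>\<close>.\<close>
  have "u + v = 2 *\<^sub>R \<psi>" by (simp add: u_def v_def scaleR_2)
  then have "u \<noteq> 0" "v \<noteq> 0" using nz uv by auto
  have bound: "norm (A x - Re E *\<^sub>R x) \<le> c * norm x"
    if "x \<in> D" "E *\<^sub>C x = A x + V y" "norm y = norm x" for x y
  proof -
    have "norm (A x - Re E *\<^sub>R x) \<le> norm (A x - E *\<^sub>C x)"
      by (rule real_shift_norm_le[OF A(1) that(1)])
    also have "\<dots> = norm (V y)" unfolding that(2) by simp
    also have "\<dots> \<le> c * norm x" using V(4)[of y] that(3) by simp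
    finally show ?thesis .
  qed
  obtain b f where f: "\<bar>b - Re E\<bar> < d" "f \<noteq> 0" "f \<in> eigenspace D A (complex_of_real b)" "parity f = f"
    using eigenvalue_near[OF A cnt D(1) _ \<open>u \<noteq> 0\<close> bound[OF D(1) eu uv[symmetric]] cd, of 1] pu by auto
  obtain b' f' where f': "\<bar>b' - Re E\<bar> < d" "f' \<noteq> 0" "f' \<in> eigenspace D A (complex_of_real b')"
    "parity f' = - f'"
    using eigenvalue_near[OF A cnt D(2) _ \<open>v \<noteq> 0\<close> bound[OF D(2) ev uv] cd, of "- 1"] pv by auto
  show False using sep[OF f(4) f'(4) f(2) f'(2) f(3) f'(3)] f(1) f'(1) by linarith
qed

section \<open>Reality of the eigenvalues and of the spectrum of \<open>H(g)\<close>\<close>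

theorem theorem2:
  fixes D :: "(real ^ 'd::finite) L2 set"
    and H\<^sub>0 :: "(real ^ 'd) L2 \<Rightarrow> (real ^ 'd) L2"
    and l :: "nat \<Rightarrow> real"
    and W :: "real ^ 'd \<Rightarrow> real"
    and \<delta> g :: real
  assumes "self_adjoint D H\<^sub>0"
    and "bounded_below D H\<^sub>0"
    and "compact_resolvent D H\<^sub>0"
    and "P_symmetric D H\<^sub>0"
    and "T_symmetric D H\<^sub>0"
    and "strict_mono l"
    and "eigenvalues D H\<^sub>0 = complex_of_real ` range l"
    and "in_Linf W"
    and "AE x in lebesgue. W (- x) = - W x"
    and "\<delta> = (INF r. l (Suc r) - l r) / 2"
    and "\<delta> > 0"
    and "\<forall>r. even_eigenvalue D H\<^sub>0 (complex_of_real (l r)) \<or>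
             odd_eigenvalue D H\<^sub>0 (complex_of_real (l r))"
    and "ereal \<bar>g\<bar> < ereal \<delta> / Linf_norm W"
  shows "(\<forall>E \<in> eigenvalues D (perturbed H\<^sub>0 W g). E \<in> \<real>) \<and>
         spectrum D (perturbed H\<^sub>0 W g) \<subseteq> \<real>"
proof -
  define U where "U x = \<i> * complex_of_real (W x)" for x
  have U: "in_Linf U" unfolding U_def using assms(8) by (rule in_Linf_imaginary)
  define B where "B = max 0 (real_of_ereal (Linf_norm W))"
  define V :: "(real ^ 'd) L2 \<Rightarrow> (real ^ 'd) L2" where "V \<psi> = complex_of_real g *\<^sub>C mult_op U \<psi>" for \<psi>
  have H: "perturbed H\<^sub>0 W g \<psi> = H\<^sub>0 \<psi> + V \<psi>" for \<psi>
    by (simp add: perturbed_def V_def U_def[abs_def])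
  have normV: "norm (V \<psi>) \<le> (\<bar>g\<bar> * B) * norm \<psi>" for \<psi>
  proof -
    have "AE x in lebesgue. norm (U x) \<le> B"
      using AE_norm_le_Linf_norm[OF assms(8)] by (simp add: U_def norm_mult B_def)
    then have "norm (mult_op U \<psi>) \<le> B * norm \<psi>"
      by (intro norm_mult_op[OF U]) (simp_all add: B_def)
    then show ?thesis by (simp add: V_def norm_scaleC mult.assoc mult_left_mono)
  qed
  have V_bl: "bounded_linear V"
  proof (rule bounded_linear_intro)
    show "V (x + y) = V x + V y" for x y
      by (simp add: V_def mult_op_add scaleC_add_right)
    show "V (r *\<^sub>R x) = r *\<^sub>R V x" for r x
      by (simp add: V_def scaleR_L2_def mult_op_scaleC scaleC_scaleC mult.commute)
    show "norm (V x) \<le> norm x * (\<bar>g\<bar> * B)" for x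
      using normV[of x] by (simp only: mult.commute)
  qed
  have V_skew: "cinner (V x) y = - cinner x (V y)" for x y
    using cinner_mult_op_imaginary[OF U, of x y]
    by (simp add: V_def U_def cinner_scaleC_left cinner_scaleC_right)
  have V_parity: "parity (V x) = - V (parity x)" for x
  proof -
    have "AE x in lebesgue. U (- x) = - U x"
      using assms(9) by eventually_elim (simp add: U_def)
    from parity_mult_op_odd[OF U this] show ?thesis
      by (simp add: V_def parity_scaleC uminus_L2_def scaleC_scaleC)
  qed
  have gB: "\<bar>g\<bar> * B < \<delta>" unfolding B_def by (rule less_divide_Linf_norm[OF assms(13,8,11)])
  have cnt: "countable (eigenvalues D H\<^sub>0)" by (simp add: assms(7))
  have gap1: "2 * \<delta> \<le> l (Suc r) - l r" for r
  proof -
    \<comment> \<open>A real infimum bounds its members from below only for a set that is bounded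
      below; monotonicity of \<open>l\<close> supplies the bound 0.\<close>
    have "bdd_below (range (\<lambda>r. l (Suc r) - l r))"
      using strict_mono_mono[OF assms(6)] by (intro bdd_belowI[of _ 0]) (auto simp: mono_def)
    then have "(INF r. l (Suc r) - l r) \<le> l (Suc r) - l r" by (rule cINF_lower) simp
    then show ?thesis by (simp add: assms(10))
  qed
  have gap: "2 * \<delta> \<le> l s - l r" if "r < s" for r s
    using gap1[of r] monoD[OF strict_mono_mono[OF assms(6)], of "Suc r" s] that by simp
  have sep: "2 * \<delta> \<le> \<bar>b - b'\<bar>" if "parity f = f" "parity f' = - f'" "f \<noteq> 0" "f' \<noteq> 0"
    "f \<in> eigenspace D H\<^sub>0 (complex_of_real b)" "f' \<in> eigenspace D H\<^sub>0 (complex_of_real b')"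
    for b b' f f'
  proof -
    have "complex_of_real b \<in> eigenvalues D H\<^sub>0" "complex_of_real b' \<in> eigenvalues D H\<^sub>0"
      using that by (auto simp: eigenvalues_def)
    then obtain r s where rs: "b = l r" "b' = l s" by (auto simp: assms(7))
    have neg: "x = 0" if "x = - x" for x :: "(real ^ 'd) L2"
      using that by (metis add.right_inverse scaleR_2 scaleR_eq_0_iff zero_neq_numeral)
    \<comment> \<open>A single eigenspace is entirely even or entirely odd. If it held both
      \<open>f\<close> and \<open>f'\<close>, the one of the wrong parity would equal its own
      negative.\<close>
    have "r \<noteq> s"
    proof
      assume "r = s"
      then show False using assms(12)[rule_format, of r] that rs neg[of f] neg[of f']
        unfolding even_eigenvalue_def odd_eigenvalue_def by metis
    qed
    then show ?thesis using gap[of r s] gap[of s r] rs by (cases r s rule: linorder_cases) auto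
  qed
  have nonreal: "\<psi> = 0" if "E \<notin> \<real>" "\<psi> \<in> D" "H\<^sub>0 \<psi> + V \<psi> = E *\<^sub>C \<psi>" for E \<psi>
    by (rule PT_nonreal_not_eigenvalue[OF assms(1,3,4) cnt V_bl V_skew V_parity normV gB _ that])
      (rule sep)
  have "E \<in> \<real>" if "E \<in> eigenvalues D (perturbed H\<^sub>0 W g)" for E
    using that nonreal[of E] by (auto simp: eigenvalues_def eigenspace_def H)
  moreover have "E \<in> resolvent_set D (perturbed H\<^sub>0 W g)" if E: "E \<notin> \<real>" for E
  proof -
    let ?T = "\<lambda>\<psi>. perturbed H\<^sub>0 W g \<psi> - E *\<^sub>C \<psi>"
    \<comment> \<open>The perturbation of \<open>H\<^sub>0\<close> is now \<open>V - E\<close>, and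
      its injectivity hypothesis is the absence of non-real eigenvalues.\<close>
    have T: "?T \<psi> = H\<^sub>0 \<psi> + (V \<psi> - E *\<^sub>C \<psi>)" for \<psi> by (simp add: H)
    have bl: "bounded_linear (\<lambda>\<psi>. V \<psi> - E *\<^sub>C \<psi>)"
      by (rule bounded_linear_sub[OF V_bl bounded_linear_scaleC])
    have inj: "x = 0" if "x \<in> D" "H\<^sub>0 x + (V x - E *\<^sub>C x) = 0" for x
      using nonreal[OF E that(1)] that(2) by (simp add: add_diff_eq)
    obtain S where S: "compact_map S" "\<And>x. S x \<in> D" "\<And>x. ?T (S x) = x"
      "\<And>x. x \<in> D \<Longrightarrow> S (?T x) = x"
      unfolding T using compact_resolvent_perturbation[OF assms(3) bl inj] by metis
    have bij: "bij_betw ?T D UNIV"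
      by (rule bij_betw_byWitness[where f' = S]) (use S in auto)
    \<comment> \<open>Injectivity on \<open>D\<close> identifies the preimage chosen by
      \<open>inv_into\<close> with \<open>S x\<close>, so the resolvent inherits the boundedness of
      \<open>S\<close>.\<close>
    have "resolvent D (perturbed H\<^sub>0 W g) E x = S x" for x
      unfolding resolvent_def using S(2,3) bij
      by (intro inv_into_f_eq) (auto simp: bij_betw_def)
    then have "resolvent D (perturbed H\<^sub>0 W g) E = S" by blast
    then show ?thesis using bij compact_map_bounded_linear[OF S(1)] by (simp add: resolvent_set_def)
  qed
  ultimately show ?thesis by (auto simp: spectrum_def)
qed

end
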